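(* Let $g:\mathbb{R}\to\mathbb{R}$ be a derivator with $\infty\notin N_g^+$, let $\mathbb{F}\in\{\mathbb{R},\mathbb{C}\}$, fix $x_0\in\mathbb{R}$, and write $g_n=g_{x_0,n}$ for the $g$-monomials centered at $x_0$. Let $m\in\mathbb{N}$, $m\ge 1$, and let $\lambda_0,\dots,\lambda_{m-1}\in\mathbb{F}$ and $c_0,\dots,c_{m-1}\in\mathbb{F}$. Let $\{a_n\}_{n\ge 0}\subset\mathbb{F}$ be the solution of the difference equation $$a_{n+m}(n+m)!=\sum_{k=0}^{m-1}\lambda_k\,a_{n+k}(n+k)!\quad (n\ge 0),\qquad a_k\,k!=c_k\quad (k\in\{0,\dots,m-1\}).$$ Then there is some $t<x_0$ such that the series $$v(x)=\sum_{n=0}^{\infty}a_n g_n(x)$$ converges absolutely on $(t,+\infty)$, $v\in\mathcal{C}^\infty_g((t,+\infty),\mathbb{F})$, and $v$ solves on $(t,+\infty)$ the initial value problem $$v^{(m)}_g(x)=\sum_{k=0}^{m-1}\lambda_k v^{(k)}_g(x),\qquad v^{(k)}_g(x_0)=c_k,\quad k\in\{0,\dots,m-1\}.$$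
   Context: A derivator is a left-continuous non-decreasing function $g:\mathbb{R}\to\mathbb{R}$. $\mu_g$ denotes its Lebesgue–Stieltjes measure, characterized on Borel sets by $\mu_g([a,b))=g(b)-g(a)$ for $a<b$. $g$-monomials centered at $x_0$: $g_{x_0,0}\equiv 1$ and, for $n\ge 1$, $g_{x_0,n}(x)=n\int_{[x_0,x)}g_{x_0,n-1}\,d\mu_g$ if $x\ge x_0$ and $g_{x_0,n}(x)=-n\int_{[x,x_0)}g_{x_0,n-1}\,d\mu_g$ if $x<x_0$. Put $\Delta g(x)=g(x^+)-g(x)$, $D_g=\{x:\Delta g(x)>0\}$, $C_g=\{x: g$ is constant on $(x-\varepsilon,x+\varepsilon)$ for some $\varepsilon>0\}$. Write the open set $C_g$ as the disjoint union of its connected components $(a_n,b_n)$, $n\in\Lambda\subset\mathbb N$ (with $a_n,b_n\in\mathbb{R}\cup\{\pm\infty\}$). Set $N_g^-=\{a_n\}_{n\in\Lambda}\setminus D_g$, $N_g^+=\{b_n\}_{n\in\Lambda}\setminus D_g$. The assumption $\infty\notin N_g^+$ means no component of $C_g$ is unbounded above. $g$-derivative: let $\Omega\subset\mathbb{R}$ be open (usual topology) and such that $b_n\in\Omega$ whenever $x\in\Omega$ and $x\in(a_n,b_n)$, a component of $C_g$. For $f:\Omega\to\mathbb{F}$ and $x\in\Omega$ (when the limit exists): $f'_g(x)=\lim_{y\to x^+}\frac{f(y)-f(x)}{g(y)-g(x)}$ if $x\in D_g$; $f'_g(x)=\lim_{y\to x}\frac{f(y)-f(x)}{g(y)-g(x)}$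 if $x\notin D_g\cup C_g$, where the limit is taken only from the right if $x\in N_g^+$ and only from the left if $x\in N_g^-$; $f'_g(x)=\lim_{y\to b_n^+}\frac{f(y)-f(b_n)}{g(y)-g(b_n)}$ if $x\in(a_n,b_n)$, a component of $C_g$. $v_g^{(k)}$ denotes the $k$-th iterated $g$-derivative, $v^{(0)}_g=v$. $f$ is $g$-continuous at $x$ if for every $\varepsilon>0$ there is $\delta>0$ such that $|f(y)-f(x)|<\varepsilon$ for all $y$ in the domain with $|g(y)-g(x)|<\delta$. $\mathcal{C}^1_g(\Omega,\mathbb{F})$ is the set of $g$-continuous $f:\Omega\to\mathbb{F}$ whose $g$-derivative exists at every point of $\Omega$ and is $g$-continuous; recursively $f\in\mathcal{C}^k_g$ if $f$ is $g$-continuous, $f'_g$ exists everywhere on $\Omega$ and $f'_g\in\mathcal{C}^{k-1}_g$; $\mathcal{C}^\infty_g=\bigcap_k\mathcal{C}^k_g$. *)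

theory Defs
  imports "HOL-Analysis.Analysis"
begin

definition derivator :: "(real \<Rightarrow> real) \<Rightarrow> bool" where
  "derivator g \<longleftrightarrow> mono g \<and> (\<forall>x. continuous (at_left x) g)"

text \<open>
  The library's \<^const>\<open>interval_measure\<close> is built from right-continuous functions and intervals
  \<open>{a<..b}\<close>. Since \<open>\<lambda>x. - g (- x)\<close> is right-continuous for a left-continuous \<open>g\<close>, the
  Lebesgue-Stieltjes measure of \<open>g\<close> is obtained by reflection. Its defining values on the
  intervals \<open>{a..<b}\<close> are checked in \<open>emeasure_stieltjes_measure\<close> below.
\<close>

definition stieltjes_measure :: "(real \<Rightarrow> real) \<Rightarrow> real measure" where
  "stieltjes_measure g = distr (interval_measure (\<lambda>x. - g (- x))) borel uminus"

lemma sets_stieltjes_measure [simp, measurable_cong]: "sets (stieltjes_measure g) = sets borel"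
  by (simp add: stieltjes_measure_def)

lemma space_stieltjes_measure [simp]: "space (stieltjes_measure g) = UNIV"
  by (simp add: stieltjes_measure_def)

lemma emeasure_stieltjes_measure:
  assumes "derivator g" "a \<le> b"
  shows "emeasure (stieltjes_measure g) {a..<b} = ennreal (g b - g a)"
proof -
  have cont: "continuous (at_right x) (\<lambda>x. - g (- x))" for x
  proof -
    have "(g \<longlongrightarrow> g (- x)) (at_left (- x))"
      using assms(1) by (simp add: derivator_def continuous_within)
    then have "((\<lambda>y. g (- y)) \<longlongrightarrow> g (- x)) (at_right x)"
      by (simp add: filterlim_at_left_to_right)
    then show ?thesis
      unfolding continuous_within by (rule tendsto_minus)
  qed
  have "uminus -` {a..<b} = {- b<..- a}"
    by auto
  then have "emeasure (stieltjes_measure g) {a..<b}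
      = emeasure (interval_measure (\<lambda>x. - g (- x))) {- b<..- a}"
    by (simp add: stieltjes_measure_def emeasure_distr)
  also have "\<dots> = ennreal (g b - g a)"
    using assms cont
    by (subst emeasure_interval_measure_Ioc) (auto simp: derivator_def mono_def)
  finally show ?thesis .
qed

primrec g_monomial :: "(real \<Rightarrow> real) \<Rightarrow> real \<Rightarrow> nat \<Rightarrow> real \<Rightarrow> real" where
  "g_monomial g x0 0 = (\<lambda>x. 1)"
| "g_monomial g x0 (Suc n) = (\<lambda>x.
     if x0 \<le> x
     then real (Suc n) * (LINT s:{x0..<x}|stieltjes_measure g. g_monomial g x0 n s)
     else - real (Suc n) * (LINT s:{x..<x0}|stieltjes_measure g. g_monomial g x0 n s))"

definition jump :: "(real \<Rightarrow> real) \<Rightarrow> real \<Rightarrow> real" where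
  "jump g x = Lim (at_right x) g - g x"

definition D_set :: "(real \<Rightarrow> real) \<Rightarrow> real set" where
  "D_set g = {x. jump g x > 0}"

definition C_set :: "(real \<Rightarrow> real) \<Rightarrow> real set" where
  "C_set g = {x. \<exists>\<epsilon>>0. g constant_on {x - \<epsilon><..<x + \<epsilon>}}"

text \<open>
  \<^term>\<open>einterval a b\<close> is the set of real numbers strictly between the extended reals \<open>a\<close> and
  \<open>b\<close>. Components are nonempty, so the endpoints of a component are determined by it.
\<close>

definition N_minus :: "(real \<Rightarrow> real) \<Rightarrow> ereal set" where
  "N_minus g = {a. \<exists>b. einterval a b \<in> components (C_set g)} - ereal ` D_set g"

definition N_plus :: "(real \<Rightarrow> real) \<Rightarrow> ereal set" where
  "N_plus g = {b. \<exists>a. einterval a b \<in> components (C_set g)} - ereal ` D_set g"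

text \<open>
  Functions on \<open>\<Omega>\<close> are total functions of which only the values on \<open>\<Omega>\<close> matter: all limits
  below are taken within \<open>\<Omega>\<close>. The notions are meant for the following domains.
\<close>

definition g_domain :: "(real \<Rightarrow> real) \<Rightarrow> real set \<Rightarrow> bool" where
  "g_domain g \<Omega> \<longleftrightarrow> open \<Omega> \<and>
     (\<forall>a b. \<forall>x\<in>\<Omega>. einterval a b \<in> components (C_set g) \<and> x \<in> einterval a b
        \<longrightarrow> b \<in> ereal ` \<Omega>)"

lemma g_domain_greaterThan:
  assumes "\<infinity> \<notin> N_plus g"
  shows "g_domain g {t<..}"
  unfolding g_domain_def
proof (intro conjI allI ballI impI)
  fix a b x
  assume x: "x \<in> {t<..}" and ab: "einterval a b \<in> components (C_set g) \<and> x \<in> einterval a b"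
  have "b \<noteq> \<infinity>"
    using assms ab by (auto simp: N_plus_def)
  moreover have xb: "ereal x < b"
    using ab by (simp add: einterval_def)
  ultimately obtain r where "b = ereal r"
    by (cases b) auto
  then show "b \<in> ereal ` {t<..}"
    using x xb by auto
qed simp

definition g_quotient ::
  "(real \<Rightarrow> real) \<Rightarrow> (real \<Rightarrow> 'a::real_normed_vector) \<Rightarrow> real \<Rightarrow> real \<Rightarrow> 'a" where
  "g_quotient g f x y = (f y - f x) /\<^sub>R (g y - g x)"

text \<open>
  The case distinctions below do not depend on their order: \<open>D_set\<close> and \<open>C_set\<close> are disjoint,
  and a real number in both \<open>N_plus\<close> and \<open>N_minus\<close> would be a continuity point of \<open>g\<close> between two
  intervals of constancy, hence in \<open>C_set\<close>.
\<close>

definition has_g_derivative ::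
  "(real \<Rightarrow> real) \<Rightarrow> real set \<Rightarrow> (real \<Rightarrow> 'a::real_normed_vector) \<Rightarrow> 'a \<Rightarrow> real \<Rightarrow> bool" where
  "has_g_derivative g \<Omega> f D x \<longleftrightarrow>
     (if x \<in> D_set g then (g_quotient g f x \<longlongrightarrow> D) (at x within \<Omega> \<inter> {x<..})
      else if x \<in> C_set g then
        (\<exists>a b. einterval a (ereal b) \<in> components (C_set g) \<and> x \<in> einterval a (ereal b) \<and>
           b \<in> \<Omega> \<and> (g_quotient g f b \<longlongrightarrow> D) (at b within \<Omega> \<inter> {b<..}))
      else if ereal x \<in> N_plus g then (g_quotient g f x \<longlongrightarrow> D) (at x within \<Omega> \<inter> {x<..})
      else if ereal x \<in> N_minus g then (g_quotient g f x \<longlongrightarrow> D) (at x within \<Omega> \<inter> {..<x})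
      else (g_quotient g f x \<longlongrightarrow> D) (at x within \<Omega>))"

definition g_deriv ::
  "(real \<Rightarrow> real) \<Rightarrow> real set \<Rightarrow> (real \<Rightarrow> 'a::real_normed_vector) \<Rightarrow> real \<Rightarrow> 'a" where
  "g_deriv g \<Omega> f x = (THE D. has_g_derivative g \<Omega> f D x)"

definition g_continuous_on ::
  "(real \<Rightarrow> real) \<Rightarrow> real set \<Rightarrow> (real \<Rightarrow> 'a::real_normed_vector) \<Rightarrow> bool" where
  "g_continuous_on g \<Omega> f \<longleftrightarrow>
     (\<forall>x\<in>\<Omega>. \<forall>\<epsilon>>0. \<exists>\<delta>>0. \<forall>y\<in>\<Omega>. \<bar>g y - g x\<bar> < \<delta> \<longrightarrow> norm (f y - f x) < \<epsilon>)"

primrec C_g ::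
  "(real \<Rightarrow> real) \<Rightarrow> real set \<Rightarrow> nat \<Rightarrow> (real \<Rightarrow> 'a::real_normed_vector) set" where
  "C_g g \<Omega> 0 = {f. g_continuous_on g \<Omega> f}"
| "C_g g \<Omega> (Suc k) = {f. g_continuous_on g \<Omega> f \<and> (\<forall>x\<in>\<Omega>. \<exists>D. has_g_derivative g \<Omega> f D x) \<and>
     g_deriv g \<Omega> f \<in> C_g g \<Omega> k}"

definition C_g_infty ::
  "(real \<Rightarrow> real) \<Rightarrow> real set \<Rightarrow> (real \<Rightarrow> 'a::real_normed_vector) set" where
  "C_g_infty g \<Omega> = (\<Inter>k. C_g g \<Omega> k)"

end

theory Submission
  imports Defs
begin

text \<open>
  Put \<open>h\<^sub>n = g\<^sub>n / n!\<close> and \<open>A\<^sub>n = a\<^sub>n n!\<close>. The recurrence makes \<open>A\<^sub>n\<close> grow at most like \<open>C L\<^sup>n\<close>. To the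
  right of \<open>x0\<close>, the Lebesgue-Stieltjes integral of \<open>\<Lambda> exp (\<Lambda> g)\<close> is at most the increment of
  \<open>exp (\<Lambda> g)\<close>, so that \<open>h\<^sub>n \<le> exp (\<Lambda> (g - g x0)) / \<Lambda>\<^sup>n\<close> for every \<open>\<Lambda> > 0\<close>; to the left there is only
  \<open>\<bar>h\<^sub>n\<bar> \<le> (g x0 - g)\<^sup>n\<close>, which is why \<open>t\<close> has to be close to \<open>x0\<close>. With \<open>\<Lambda> = 2 L\<close> the series
  \<open>v\<^sub>j = \<Sum>n. A\<^sub>n\<^sub>+\<^sub>j h\<^sub>n\<close> converge geometrically, are Lipschitz with respect to \<open>g\<close>, and satisfy
  \<open>v\<^sub>j y - v\<^sub>j x - (g y - g x) v\<^sub>j\<^sub>+\<^sub>1 x = o(g y - g x)\<close>, hence \<open>v\<^sub>j\<^sub>+\<^sub>1\<close> is the derivative of \<open>v\<^sub>j\<close>. The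
  differential equation is then the recurrence, summed against \<open>h\<^sub>n\<close>.

  Only the real functions \<open>h\<^sub>n\<close> are integrated, because the Bochner integral needs a second countable
  range, which is not assumed of the scalar field.
\<close>

section \<open>Open connected sets of reals\<close>

text \<open>The infimum and supremum in the extended reals serve as endpoints, which covers
  unbounded sets as well: openness keeps both strictly away from every point of \<open>S\<close>,
  and connectedness fills the gap between them.\<close>

lemma open_connected_imp_einterval:
  fixes S :: "real set"
  assumes "open S" "connected S" "S \<noteq> {}"
  shows "\<exists>a b. S = einterval a b"
proof (intro exI subset_antisym subsetI)
  let ?a = "Inf (ereal ` S)" and ?b = "Sup (ereal ` S)"
  fix x
  show "x \<in> einterval ?a ?b" if x: "x \<in> S"
  proof -
    obtain e where e: "e > 0" "ball x e \<subseteq> S"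
      using assms(1) x unfolding open_contains_ball by blast
    then have "x - e / 2 \<in> S" "x + e / 2 \<in> S"
      by (auto simp: ball_eq_greaterThanLessThan subset_iff)
    then have "?a \<le> ereal (x - e / 2)" "ereal (x + e / 2) \<le> ?b"
      by (auto intro: INF_lower SUP_upper)
    moreover have "ereal (x - e / 2) < ereal x" "ereal x < ereal (x + e / 2)"
      using e(1) by auto
    ultimately show ?thesis
      unfolding einterval_iff by (meson le_less_trans less_le_trans)
  qed
  show "x \<in> S" if "x \<in> einterval ?a ?b"
  proof -
    have "?a < ereal x" "ereal x < ?b"
      using that by (simp_all add: einterval_iff)
    then obtain y z where "y \<in> S" "z \<in> S" "y < x" "x < z"
      unfolding INF_less_iff less_SUP_iff by auto
    then show ?thesis
      using assms(2) connected_contains_Icc[of S y z] by (auto simp: subset_iff)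
  qed
qed

section \<open>Stieltjes integrals over half-open intervals\<close>

locale derivator_fun =
  fixes g :: "real \<Rightarrow> real"
  assumes derivator: "derivator g"
begin

abbreviation "\<mu> \<equiv> stieltjes_measure g"

lemma g_mono: "x \<le> y \<Longrightarrow> g x \<le> g y"
  using derivator by (simp add: derivator_def mono_def)

lemma g_tendsto_left: "(g \<longlongrightarrow> g x) (at_left x)"
  using derivator by (simp add: derivator_def continuous_within)

lemma emeasure_Ico: "a \<le> b \<Longrightarrow> emeasure \<mu> {a..<b} = ennreal (g b - g a)"
  by (rule emeasure_stieltjes_measure[OF derivator])

lemma measure_Ico: "a \<le> b \<Longrightarrow> measure \<mu> {a..<b} = g b - g a"
  by (simp add: measure_def emeasure_Ico g_mono)

lemma set_integrable_bounded:
  fixes f :: "real \<Rightarrow> real"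
  assumes "f \<in> borel_measurable borel" "\<And>s. s \<in> {p..<q} \<Longrightarrow> \<bar>f s\<bar> \<le> B"
  shows "set_integrable \<mu> {p..<q} f"
proof (cases "p \<le> q")
  case True
  have "f \<in> borel_measurable \<mu>"
    using assms(1) by (simp add: measurable_cong_sets[OF sets_stieltjes_measure refl])
  then show ?thesis
    unfolding set_integrable_def
    using assms(2) True by (intro integrableI_bounded_set_indicator[where B=B]) (auto simp: emeasure_Ico)
qed (simp add: set_integrable_def)

lemma set_integral_const_Ico: "p \<le> q \<Longrightarrow> (LINT s:{p..<q}|\<mu>. B) = B * (g q - g p)"
  by (subst set_integral_const) (auto simp: emeasure_Ico measure_Ico)

lemma set_integral_abs_le:
  assumes "f \<in> borel_measurable borel" "\<And>s. s \<in> {p..<q} \<Longrightarrow> \<bar>f s\<bar> \<le> B" "p \<le> q"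
  shows "\<bar>LINT s:{p..<q}|\<mu>. f s\<bar> \<le> B * (g q - g p)"
proof -
  have f: "set_integrable \<mu> {p..<q} f"
    by (rule set_integrable_bounded[OF assms(1,2)])
  have "f s \<le> B" "- B \<le> f s" if "s \<in> {p..<q}" for s
    using assms(2)[OF that] by (simp_all add: abs_le_iff)
  note le = this
  have c: "set_integrable \<mu> {p..<q} (\<lambda>_. c::real)" for c
    by (rule set_integrable_bounded[where B="\<bar>c\<bar>"]) auto
  have "(LINT s:{p..<q}|\<mu>. f s) \<le> (LINT s:{p..<q}|\<mu>. B)"
    by (intro set_integral_mono f c) (rule le(1))
  moreover have "(LINT s:{p..<q}|\<mu>. - B) \<le> (LINT s:{p..<q}|\<mu>. f s)"
    by (intro set_integral_mono f c) (rule le(2))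
  ultimately show ?thesis
    using set_integral_const_Ico[OF assms(3)] by (simp add: abs_le_iff)
qed

lemma set_integral_Ico_split:
  fixes f :: "real \<Rightarrow> real"
  assumes "f \<in> borel_measurable borel" "\<And>s. s \<in> {p..<r} \<Longrightarrow> \<bar>f s\<bar> \<le> B" "p \<le> q" "q \<le> r"
  shows "(LINT s:{p..<r}|\<mu>. f s) = (LINT s:{p..<q}|\<mu>. f s) + (LINT s:{q..<r}|\<mu>. f s)"
proof -
  have "{p..<r} = {p..<q} \<union> {q..<r}"
    using assms by auto
  then show ?thesis
    using assms by (simp only:) (intro set_integral_Un set_integrable_bounded[where B=B], auto)
qed

section \<open>Oriented integrals from a base point\<close>

text \<open>One application is one step of the recursion for \<open>g_monomial\<close>, up to the
  factor \<open>Suc n\<close>.\<close>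

definition signed_integral :: "real \<Rightarrow> (real \<Rightarrow> real) \<Rightarrow> real \<Rightarrow> real" where
  "signed_integral x0 f x =
     (if x0 \<le> x then (LINT s:{x0..<x}|\<mu>. f s) else - (LINT s:{x..<x0}|\<mu>. f s))"

text \<open>The invariant carried through the recursion: it gives integrability over every interval
  \<open>{p..<q}\<close> and passes on to the signed integral.\<close>

definition locally_bounded_borel :: "(real \<Rightarrow> real) \<Rightarrow> bool" where
  "locally_bounded_borel f \<longleftrightarrow> f \<in> borel_measurable borel \<and> (\<forall>p q. \<exists>B. \<forall>s\<in>{p..q}. \<bar>f s\<bar> \<le> B)"

text \<open>Half-open intervals adjoin without overlap, so an atom at a division point is counted
  exactly once. The three cases are the positions of \<open>x0\<close> relative to \<open>x\<close>
  and \<open>y\<close>.\<close>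

lemma signed_integral_diff:
  assumes "locally_bounded_borel f" "x \<le> y"
  shows "signed_integral x0 f y - signed_integral x0 f x = (LINT s:{x..<y}|\<mu>. f s)"
proof -
  have m: "f \<in> borel_measurable borel"
    using assms by (simp add: locally_bounded_borel_def)
  obtain B where "\<forall>s\<in>{min x0 x..max x0 y}. \<bar>f s\<bar> \<le> B"
    using assms(1) unfolding locally_bounded_borel_def by blast
  then have B: "\<bar>f s\<bar> \<le> B" if "min x0 x \<le> s" "s \<le> max x0 y" for s
    using that by auto
  have split: "(LINT s:{p..<r}|\<mu>. f s) = (LINT s:{p..<q}|\<mu>. f s) + (LINT s:{q..<r}|\<mu>. f s)"
    if "min x0 x \<le> p" "p \<le> q" "q \<le> r" "r \<le> max x0 y" for p q r
    using that by (intro set_integral_Ico_split[OF m, where B=B] B) auto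
  consider "x0 \<le> x" | "x < x0" "x0 \<le> y" | "x < x0" "y < x0"
    by linarith
  then show ?thesis
  proof cases
    case 1
    then show ?thesis
      using split[of x0 x y] assms(2) by (simp add: signed_integral_def)
  next
    case 2
    then show ?thesis
      using split[of x x0 y] assms(2) by (simp add: signed_integral_def)
  next
    case 3
    then show ?thesis
      using split[of x y x0] assms(2) by (simp add: signed_integral_def)
  qed
qed

text \<open>On a bounded interval \<open>signed_integral x0 f + B g\<close> is monotone as soon as \<open>\<bar>f\<bar> \<le> B\<close>; this
  gives the measurability.\<close>

lemma locally_bounded_borel_signed_integral:
  assumes "locally_bounded_borel f"
  shows "locally_bounded_borel (signed_integral x0 f)"
proof -
  let ?F = "signed_integral x0 f"
  have m: "f \<in> borel_measurable borel"
    using assms by (simp add: locally_bounded_borel_def)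
  have "\<exists>B. \<forall>s\<in>{p..q}. \<forall>r\<in>{p..q}. s \<le> r \<longrightarrow> \<bar>?F r - ?F s\<bar> \<le> B * (g r - g s)" for p q
  proof -
    obtain B where B: "\<forall>s\<in>{p..q}. \<bar>f s\<bar> \<le> B"
      using assms unfolding locally_bounded_borel_def by blast
    have "\<bar>?F r - ?F s\<bar> \<le> B * (g r - g s)" if "p \<le> s" "s \<le> r" "r \<le> q" for r s
      unfolding signed_integral_diff[OF assms that(2)]
      using that B by (intro set_integral_abs_le[OF m]) auto
    then show ?thesis
      by (intro exI[of _ B]) auto
  qed
  then obtain B where B: "\<And>p q s r. s \<in> {p..q} \<Longrightarrow> r \<in> {p..q} \<Longrightarrow> s \<le> r \<Longrightarrow>
      \<bar>?F r - ?F s\<bar> \<le> B p q * (g r - g s)"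
    by metis
  have "\<exists>C. \<forall>s\<in>{p..q}. \<bar>?F s\<bar> \<le> C" for p q
  proof (intro exI ballI)
    fix s assume s: "s \<in> {p..q}"
    have "\<bar>?F s - ?F p\<bar> \<le> B p q * (g s - g p)"
      using s by (intro B) auto
    also have "\<dots> \<le> \<bar>B p q\<bar> * (g q - g p)"
      using s by (intro mult_mono) (auto intro: g_mono)
    finally show "\<bar>?F s\<bar> \<le> \<bar>?F p\<bar> + \<bar>B p q\<bar> * (g q - g p)"
      by linarith
  qed
  \<comment> \<open>The slope \<open>B p q\<close> depends on the interval, so monotonicity holds
    only piecewise; countably many intervals cover the line.\<close>
  moreover have "?F \<in> borel_measurable borel"
  proof (rule measurable_piecewise_restrict[where C="range (\<lambda>n. {- real n..real n})"])
    fix S assume "S \<in> range (\<lambda>n. {- real n..real n})"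
    then obtain n :: nat where S: "S = {- real n..real n}"
      by auto
    define b where "b = B (- real n) (real n)"
    have "mono_on S (\<lambda>s. ?F s + b * g s)"
    proof (rule mono_onI)
      fix r s assume "r \<in> S" "s \<in> S" "r \<le> s"
      then have "\<bar>?F s - ?F r\<bar> \<le> b * (g s - g r)"
        unfolding b_def S by (intro B) auto
      then show "?F r + b * g r \<le> ?F s + b * g s"
        by (simp add: algebra_simps)
    qed
    then have "(\<lambda>s. ?F s + b * g s) \<in> borel_measurable (restrict_space borel S)"
      by (rule borel_measurable_mono_on_fnc)
    moreover have "g \<in> borel_measurable (restrict_space borel S)"
      using derivator
      by (intro measurable_restrict_space1 borel_measurable_mono) (simp add: derivator_def)
    ultimately have "(\<lambda>s. (?F s + b * g s) - b * g s) \<in> borel_measurable (restrict_space borel S)"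
      by (intro borel_measurable_diff borel_measurable_times borel_measurable_const)
    then show "?F \<in> borel_measurable (restrict_space borel S)"
      by simp
  next
    show "space borel \<subseteq> \<Union> (range (\<lambda>n. {- real n..real n}))"
    proof
      fix x :: real
      obtain n :: nat where "\<bar>x\<bar> \<le> real n"
        using real_arch_simple by blast
      then show "x \<in> \<Union> (range (\<lambda>n. {- real n..real n}))"
        by (auto simp: abs_le_iff intro!: exI[of _ n])
    qed
  qed auto
  ultimately show ?thesis
    by (simp add: locally_bounded_borel_def)
qed

text \<open>The step functions sampling \<open>f\<close> at the left endpoints of a grid converge to \<open>f\<close> pointwise by
  left continuity, also at the jumps of \<open>g\<close>.\<close>

lemma set_integral_le_left_sums:
  fixes f F :: "real \<Rightarrow> real"
  assumes m: "f \<in> borel_measurable borel"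
    and B: "\<And>s. s \<in> {p..q} \<Longrightarrow> \<bar>f s\<bar> \<le> B"
    and cont: "\<And>s. s \<in> {p..q} \<Longrightarrow> (f \<longlongrightarrow> f s) (at_left s)"
    and le: "\<And>a b. p \<le> a \<Longrightarrow> a \<le> b \<Longrightarrow> b \<le> q \<Longrightarrow> f a * (g b - g a) \<le> F b - F a"
    and "p \<le> q"
  shows "(LINT s:{p..<q}|\<mu>. f s) \<le> F q - F p"
proof -
  \<comment> \<open>\<open>r N s\<close> is the last point of the grid
    \<open>p + k / (N + 1)\<close> that does not exceed \<open>s\<close>; \<open>u N\<close> samples
    \<open>f\<close> there.\<close>
  define r where "r N s = p + of_int \<lfloor>(s - p) * real (Suc N)\<rfloor> / real (Suc N)" for N s
  define u where "u N s = f (r N s)" for N s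
  have r: "p \<le> r N s" "r N s \<le> s" "s - inverse (real (Suc N)) \<le> r N s" if "p \<le> s" for N s
  proof -
    have fl: "0 \<le> \<lfloor>(s - p) * real (Suc N)\<rfloor>"
      using that by simp
    then show "p \<le> r N s"
      by (simp add: r_def)
    have "of_int \<lfloor>(s - p) * real (Suc N)\<rfloor> / real (Suc N) \<le> (s - p) * real (Suc N) / real (Suc N)"
      by (intro divide_right_mono of_int_floor_le) simp
    then show "r N s \<le> s"
      by (simp add: r_def)
    have "((s - p) * real (Suc N) - 1) / real (Suc N) \<le> of_int \<lfloor>(s - p) * real (Suc N)\<rfloor> / real (Suc N)"
      by (intro divide_right_mono) linarith+
    moreover have "((s - p) * real (Suc N) - 1) / real (Suc N) = s - p - inverse (real (Suc N))"
      by (simp add: field_simps)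
    ultimately show "s - inverse (real (Suc N)) \<le> r N s"
      by (simp add: r_def)
  qed
  have mu: "u N \<in> borel_measurable borel" for N
    unfolding u_def r_def using m by measurable
  have uB: "\<bar>u N s\<bar> \<le> B" if "s \<in> {p..q}" for N s
    using that r[of s N] by (auto simp: u_def intro!: B)
  \<comment> \<open>The grid points are cut off at \<open>q\<close>, so the last proper cell may be
    shorter and all later ones are empty.\<close>
  define e where "e N k = min q (p + real k / real (Suc N))" for N k
  have e: "p \<le> e N k" "e N k \<le> e N (Suc k)" "e N k \<le> q" for N k
    using \<open>p \<le> q\<close> unfolding e_def by (simp, intro min.mono add_mono divide_right_mono, auto)
  \<comment> \<open>Cell by cell the integral of the step function is
    \<open>f a * (g b - g a)\<close>, and the bounds by increments of \<open>F\<close>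
    telescope.\<close>
  have "(LINT s:{p..<e N k}|\<mu>. u N s) \<le> F (e N k) - F p" for N k
  proof (induction k)
    case 0
    have "e N 0 = p"
      using \<open>p \<le> q\<close> by (simp add: e_def)
    then show ?case
      by (simp add: set_lebesgue_integral_def)
  next
    case (Suc k)
    let ?a = "e N k" and ?b = "e N (Suc k)"
    have "u N s = f ?a" if s: "s \<in> {?a..<?b}" for s
    proof -
      \<comment> \<open>A point \<open>s\<close> of the cell forces \<open>?a < q\<close>, so the
        left end was not cut off.\<close>
      have a: "?a = p + real k / real (Suc N)"
        using s by (auto simp: e_def min_def split: if_splits)
      have "p + real k / real (Suc N) \<le> s" "s < p + real (Suc k) / real (Suc N)"
        using s a by (auto simp: e_def)
      then have "real k \<le> (s - p) * real (Suc N)" "(s - p) * real (Suc N) < real k + 1"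
        by (simp_all add: field_simps)
      then have "\<lfloor>(s - p) * real (Suc N)\<rfloor> = int k"
        by (intro floor_unique) auto
      then show ?thesis
        by (simp add: u_def r_def a)
    qed
    then have "(LINT s:{?a..<?b}|\<mu>. u N s) = (LINT s:{?a..<?b}|\<mu>. f ?a)"
      by (intro set_lebesgue_integral_cong) auto
    also have "\<dots> = f ?a * (g ?b - g ?a)"
      using e by (intro set_integral_const_Ico)
    also have "\<dots> \<le> F ?b - F ?a"
      using e by (intro le)
    moreover have "(LINT s:{p..<?b}|\<mu>. u N s) = (LINT s:{p..<?a}|\<mu>. u N s) + (LINT s:{?a..<?b}|\<mu>. u N s)"
    proof (rule set_integral_Ico_split[OF mu, where B=B])
      show "\<bar>u N s\<bar> \<le> B" if "s \<in> {p..<?b}" for s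
        using that e(3)[of N "Suc k"] by (intro uB) auto
    qed (use e in auto)
    ultimately show ?case
      using Suc by linarith
  qed
  moreover have "\<exists>k. e N k = q" for N
  proof -
    obtain k :: nat where "(q - p) * real (Suc N) \<le> real k"
      using real_arch_simple by blast
    then have "q \<le> p + real k / real (Suc N)"
      by (simp add: field_simps)
    then show ?thesis
      by (auto simp: e_def intro!: exI[of _ k])
  qed
  ultimately have uF: "(LINT s:{p..<q}|\<mu>. u N s) \<le> F q - F p" for N
    by metis
  have lim: "(\<lambda>N. u N s) \<longlonglongrightarrow> f s" if s: "s \<in> {p..q}" for s
  proof (rule tendstoI)
    fix \<epsilon> :: real assume "\<epsilon> > 0"
    then have "\<forall>\<^sub>F y in at_left s. dist (f y) (f s) < \<epsilon>"
      using cont[OF s] by (simp add: tendsto_iff)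
    then obtain d where d: "d < s" "\<And>y. d < y \<Longrightarrow> y < s \<Longrightarrow> dist (f y) (f s) < \<epsilon>"
      unfolding eventually_at_left_field by blast
    have "(\<lambda>N. inverse (real (Suc N))) \<longlonglongrightarrow> 0"
      by (rule LIMSEQ_inverse_real_of_nat)
    then have "\<forall>\<^sub>F N in sequentially. inverse (real (Suc N)) < s - d"
      using d(1) by (intro order_tendstoD) auto
    then show "\<forall>\<^sub>F N in sequentially. dist (u N s) (f s) < \<epsilon>"
    proof eventually_elim
      case (elim N)
      then have "d < r N s" "r N s \<le> s"
        using r[of s N] s by auto
      then show ?case
        using d(2)[of "r N s"] \<open>\<epsilon> > 0\<close> by (cases "r N s = s") (auto simp: u_def)
    qed
  qed
  have fm: "f \<in> borel_measurable \<mu>" and um: "u N \<in> borel_measurable \<mu>" for N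
    using m mu by (simp_all add: measurable_cong_sets[OF sets_stieltjes_measure refl])
  \<comment> \<open>Dominated convergence: the constant \<open>B\<close> is integrable because the
    interval has finite measure.\<close>
  have "(\<lambda>N. LINT s:{p..<q}|\<mu>. u N s) \<longlonglongrightarrow> (LINT s:{p..<q}|\<mu>. f s)"
    unfolding set_lebesgue_integral_def
  proof (rule integral_dominated_convergence[where w="\<lambda>s. indicator {p..<q} s *\<^sub>R B"])
    show "integrable \<mu> (\<lambda>s. indicator {p..<q} s *\<^sub>R B)"
      using set_integrable_bounded[of "\<lambda>_. B" p q "\<bar>B\<bar>"] by (simp add: set_integrable_def)
    show "AE s in \<mu>. (\<lambda>N. indicator {p..<q} s *\<^sub>R u N s) \<longlonglongrightarrow> indicator {p..<q} s *\<^sub>R f s"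
      by (intro AE_I2) (simp add: indicator_def lim)
    show "AE s in \<mu>. norm (indicator {p..<q} s *\<^sub>R u N s) \<le> indicator {p..<q} s *\<^sub>R B" for N
      by (intro AE_I2) (auto simp: indicator_def intro: uB)
  qed (use fm um in \<open>auto intro!: borel_measurable_scaleR borel_measurable_indicator\<close>)
  then show ?thesis
    by (rule LIMSEQ_le_const2) (use uF in auto)
qed

text \<open>The inequality for left sums is \<open>1 + z \<le> exp z\<close> with
  \<open>z = \<Lambda> * (g b - g a)\<close>. At a jump of \<open>g\<close> the integrand takes the
  lower value, which is why the result is an inequality in this direction.\<close>

lemma set_integral_exp_le:
  assumes "p \<le> q" "\<Lambda> > 0"
  shows "(LINT s:{p..<q}|\<mu>. \<Lambda> * exp (\<Lambda> * (g s - c))) \<le> exp (\<Lambda> * (g q - c)) - exp (\<Lambda> * (g p - c))"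
proof (rule set_integral_le_left_sums[where B="\<Lambda> * exp (\<Lambda> * (g q - c))"])
  have [measurable]: "g \<in> borel_measurable borel"
    using derivator by (intro borel_measurable_mono) (simp add: derivator_def)
  show "(\<lambda>s. \<Lambda> * exp (\<Lambda> * (g s - c))) \<in> borel_measurable borel"
    by measurable
  show "((\<lambda>s. \<Lambda> * exp (\<Lambda> * (g s - c))) \<longlongrightarrow> \<Lambda> * exp (\<Lambda> * (g s - c))) (at_left s)" for s
    by (intro tendsto_intros g_tendsto_left)
  show "\<bar>\<Lambda> * exp (\<Lambda> * (g s - c))\<bar> \<le> \<Lambda> * exp (\<Lambda> * (g q - c))" if "s \<in> {p..q}" for s
    using that assms by (auto simp: abs_mult intro: g_mono)
  show "\<Lambda> * exp (\<Lambda> * (g a - c)) * (g b - g a) \<le> exp (\<Lambda> * (g b - c)) - exp (\<Lambda> * (g a - c))" for a b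
  proof -
    have "exp (\<Lambda> * (g a - c)) * (1 + \<Lambda> * (g b - g a)) \<le> exp (\<Lambda> * (g a - c)) * exp (\<Lambda> * (g b - g a))"
      by (intro mult_left_mono exp_ge_add_one_self) auto
    also have "\<dots> = exp (\<Lambda> * (g b - c))"
      by (simp add: exp_add[symmetric] algebra_simps)
    finally show ?thesis
      by (simp add: algebra_simps)
  qed
qed (use assms in auto)

section \<open>Components of the set of constancy\<close>

text \<open>The value g(x+) from the definition of \<open>jump\<close>. It gets a name because the
  error estimates to the right of a jump involve \<open>g y - right_limit x\<close>.\<close>

definition right_limit :: "real \<Rightarrow> real" where
  "right_limit x = Lim (at_right x) g"

lemma right_limit_tendsto: "(g \<longlongrightarrow> right_limit x) (at_right x)"
proof -
  have "(g \<longlongrightarrow> Inf (g ` ({x<..} \<inter> UNIV))) (at x within ({x<..} \<inter> UNIV))"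
    by (rule Lim_right_bound[where K="g x"]) (auto intro: g_mono)
  then show ?thesis
    unfolding right_limit_def by (simp add: tendsto_Lim)
qed

lemma right_limit_le:
  assumes "x < y"
  shows "right_limit x \<le> g y"
proof (rule tendsto_upperbound[OF right_limit_tendsto])
  show "\<forall>\<^sub>F z in at_right x. g z \<le> g y"
    using assms unfolding eventually_at_right_field by (intro exI[of _ y]) (auto intro: g_mono)
qed simp

lemma le_right_limit: "g x \<le> right_limit x"
proof (rule tendsto_lowerbound[OF right_limit_tendsto])
  show "\<forall>\<^sub>F z in at_right x. g x \<le> g z"
    unfolding eventually_at_right_field by (intro exI[of _ "x + 1"]) (auto intro: g_mono)
qed simp

lemma D_set_iff: "x \<in> D_set g \<longleftrightarrow> g x < right_limit x"
  by (auto simp: D_set_def jump_def right_limit_def)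

lemma right_limit_eqI:
  assumes "x < y" "\<And>z. z \<in> {x<..<y} \<Longrightarrow> g z = c"
  shows "right_limit x = c"
proof (rule tendsto_unique[OF _ right_limit_tendsto])
  have "\<forall>\<^sub>F z in at_right x. g z = c"
    using assms unfolding eventually_at_right_field by auto
  then show "(g \<longlongrightarrow> c) (at_right x)"
    by (rule tendsto_eventually)
qed simp

lemma g_eq_right_endpoint:
  assumes "x < y" "\<And>z. z \<in> {x<..<y} \<Longrightarrow> g z = c"
  shows "g y = c"
proof (rule tendsto_unique[OF _ g_tendsto_left])
  have "\<forall>\<^sub>F z in at_left y. g z = c"
    using assms unfolding eventually_at_left_field by auto
  then show "(g \<longlongrightarrow> c) (at_left y)"
    by (rule tendsto_eventually)
qed simp

section \<open>Intervals of constancy and strict growth at their ends\<close>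

lemma C_setI:
  assumes "a < x" "x < b" "\<And>z. z \<in> {a<..<b} \<Longrightarrow> g z = c"
  shows "x \<in> C_set g"
proof -
  have "g constant_on {x - min (x - a) (b - x)<..<x + min (x - a) (b - x)}"
    unfolding constant_on_def by (intro exI[of _ c] ballI assms) auto
  then show ?thesis
    using assms(1,2) unfolding C_set_def
    by (auto intro!: exI[of _ "min (x - a) (b - x)"])
qed

lemma open_C_set: "open (C_set g)"
proof (rule openI)
  fix x assume "x \<in> C_set g"
  then obtain \<epsilon> c where e: "\<epsilon> > 0" "\<And>z. z \<in> {x - \<epsilon><..<x + \<epsilon>} \<Longrightarrow> g z = c"
    unfolding C_set_def constant_on_def by auto
  have "{x - \<epsilon><..<x + \<epsilon>} \<subseteq> C_set g"
    using e(2) by (auto intro: C_setI)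
  then show "\<exists>e>0. ball x e \<subseteq> C_set g"
    using e(1) by (auto simp: ball_eq_greaterThanLessThan)
qed

lemma Ioo_subset_C_set:
  assumes "g x = g y"
  shows "{x<..<y} \<subseteq> C_set g"
proof
  fix z assume z: "z \<in> {x<..<y}"
  have "g w = g x" if "w \<in> {x<..<y}" for w
    using that g_mono[of x w] g_mono[of w y] assms by simp
  then show "z \<in> C_set g"
    using z by (intro C_setI[of x z y]) auto
qed

lemma g_constant_on_connected_subset:
  assumes "connected S" "S \<subseteq> C_set g"
  shows "g constant_on S"
proof (rule locally_constant_imp_constant[OF assms(1)])
  fix x assume x: "x \<in> S"
  then obtain \<epsilon> where "\<epsilon> > 0" "g constant_on {x - \<epsilon><..<x + \<epsilon>}"
    using assms(2) unfolding C_set_def by auto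
  with x show "\<exists>T. openin (top_of_set S) T \<and> x \<in> T \<and> (\<forall>y\<in>T. g y = g x)"
    by (intro exI[of _ "S \<inter> {x - \<epsilon><..<x + \<epsilon>}"]) (auto simp: constant_on_def openin_open)
qed

lemma subset_component:
  assumes "connected S" "S \<subseteq> C_set g" "S \<noteq> {}"
  obtains a b where "einterval a b \<in> components (C_set g)" "S \<subseteq> einterval a b"
proof -
  obtain T where T: "T \<in> components (C_set g)" "S \<subseteq> T"
    using exists_component_superset[of S "C_set g"] assms by auto
  have "\<exists>a b. T = einterval a b"
    using open_components[OF open_C_set T(1)] in_components_connected[OF T(1)]
      in_components_nonempty[OF T(1)]
    by (rule open_connected_imp_einterval)
  then show ?thesis
    using T that by auto
qed

text \<open>Otherwise the segment from a point of the component to \<open>r\<close> would be a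
  connected subset of \<open>C_set g\<close>; by maximality it would lie in the component, which as
  an open interval omits its endpoints.\<close>

lemma component_endpoint_notin_C_set:
  assumes ab: "einterval a b \<in> components (C_set g)" and "a = ereal r \<or> b = ereal r"
  shows "r \<notin> C_set g"
proof
  assume r: "r \<in> C_set g"
  obtain x where x: "x \<in> einterval a b"
    using in_components_nonempty[OF ab] by auto
  have "closed_segment x r \<subseteq> insert r (einterval a b)"
  proof
    fix s assume "s \<in> closed_segment x r"
    then have s: "x \<le> s \<and> s \<le> r \<or> r \<le> s \<and> s \<le> x"
      by (auto simp: closed_segment_eq_real_ivl split: if_splits)
    have "s \<in> einterval a b" if "s \<noteq> r"
      using assms(2)
    proof
      assume "a = ereal r"
      moreover from this have "r < x"
        using x by (simp add: einterval_iff)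
      ultimately show ?thesis
        using s x that by (auto simp: einterval_iff intro: le_less_trans[of "ereal s" "ereal x"])
    next
      assume "b = ereal r"
      moreover from this have "x < r"
        using x by (simp add: einterval_iff)
      ultimately show ?thesis
        using s x that by (auto simp: einterval_iff intro: less_le_trans[of _ "ereal x" "ereal s"])
    qed
    then show "s \<in> insert r (einterval a b)"
      by auto
  qed
  also have "\<dots> \<subseteq> C_set g"
    using r in_components_subset[OF ab] by auto
  finally have "closed_segment x r \<subseteq> einterval a b"
    using x by (intro components_maximal[OF ab]) auto
  then have "r \<in> einterval a b"
    by auto
  then show False
    using assms(2) by (auto simp: einterval_iff)
qed

lemma g_eq_on_component:
  assumes "einterval a b \<in> components (C_set g)" "x \<in> einterval a b" "y \<in> einterval a b"
  shows "g x = g y"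
  using g_constant_on_connected_subset[OF in_components_connected in_components_subset] assms
  unfolding constant_on_def by metis

text \<open>Left continuity carries the constant value to the right endpoint, even if
  \<open>g\<close> jumps there.\<close>

lemma g_eq_right_endpoint_component:
  assumes "einterval a (ereal b) \<in> components (C_set g)" "x \<in> einterval a (ereal b)"
  shows "g b = g x"
proof (rule g_eq_right_endpoint)
  show "x < b"
    using assms(2) by (simp add: einterval_iff)
  show "g z = g x" if "z \<in> {x<..<b}" for z
    using that assms(2)
    by (intro g_eq_on_component[OF assms(1)]) (auto simp: einterval_iff intro: less_trans)
qed

text \<open>Equality would extend the constancy across \<open>b\<close> and put this endpoint into
  \<open>C_set g\<close>. The strict inequality makes the difference quotients at \<open>b\<close>
  meaningful.\<close>

lemma g_less_right_of_component:
  assumes ab: "einterval a (ereal b) \<in> components (C_set g)" and "b < y"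
  shows "g b < g y"
proof (rule ccontr)
  assume "\<not> g b < g y"
  then have eq: "g y = g b"
    using g_mono[of b y] \<open>b < y\<close> by simp
  obtain x where x: "x \<in> einterval a (ereal b)"
    using in_components_nonempty[OF ab] by auto
  have "g z = g b" if "z \<in> {x<..<y}" for z
    using that eq g_mono[of x z] g_mono[of z y] g_eq_right_endpoint_component[OF ab x] by force
  moreover have "x < b"
    using x by (simp add: einterval_iff)
  ultimately have "b \<in> C_set g"
    using \<open>b < y\<close> by (intro C_setI[of x b y])
  then show False
    using component_endpoint_notin_C_set[OF ab] by simp
qed

text \<open>At a left endpoint left continuity says nothing about the component; it is the absence
  of a jump at \<open>a\<close> that identifies \<open>g a\<close> with the constant value. Then
  equality to the left would again put \<open>a\<close> into \<open>C_set g\<close>.\<close>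

lemma g_less_left_of_component:
  assumes ab: "einterval (ereal a) b \<in> components (C_set g)" and "y < a" "a \<notin> D_set g"
  shows "g y < g a"
proof (rule ccontr)
  assume "\<not> g y < g a"
  then have eq: "g y = g a"
    using g_mono[of y a] \<open>y < a\<close> by simp
  obtain x where x: "x \<in> einterval (ereal a) b"
    using in_components_nonempty[OF ab] by auto
  then have "a < x" "ereal x < b"
    by (simp_all add: einterval_iff)
  have "g z = g x" if "z \<in> {a<..<x}" for z
  proof (rule g_eq_on_component[OF ab _ x])
    have "ereal z < b"
      using that \<open>ereal x < b\<close> by (intro less_trans[of "ereal z" "ereal x" b]) simp_all
    then show "z \<in> einterval (ereal a) b"
      using that by (simp add: einterval_iff)
  qed
  then have "right_limit a = g x"
    using \<open>a < x\<close> by (intro right_limit_eqI[of a x])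
  then have "g x = g a"
    using \<open>a \<notin> D_set g\<close> le_right_limit[of a] by (simp add: D_set_iff)
  then have "g z = g a" if "z \<in> {y<..<x}" for z
    using that eq g_mono[of y z] g_mono[of z x] by force
  then have "a \<in> C_set g"
    using \<open>a < x\<close> \<open>y < a\<close> by (intro C_setI[of y a x])
  then show False
    using component_endpoint_notin_C_set[OF ab] by simp
qed

text \<open>A jump gives the inequality at once. Without a jump, a constant stretch to the right of
  \<open>x\<close> lies in a component; as \<open>x\<close> is outside \<open>C_set g\<close>, its
  left endpoint is \<open>x\<close>, which then belongs to \<open>N_minus g\<close>.\<close>

lemma g_less_right:
  assumes "x \<notin> C_set g" "ereal x \<notin> N_minus g" "x < y"
  shows "g x < g y"
proof (cases "x \<in> D_set g")
  case True
  then show ?thesis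
    using right_limit_le[OF \<open>x < y\<close>] by (simp add: D_set_iff)
next
  case False
  show ?thesis
  proof (rule ccontr)
    assume "\<not> g x < g y"
    then have "g x = g y"
      using g_mono[of x y] \<open>x < y\<close> by simp
    then obtain a b where ab: "einterval a b \<in> components (C_set g)" "{x<..<y} \<subseteq> einterval a b"
      using subset_component[OF connected_Ioo Ioo_subset_C_set[of x y]] \<open>x < y\<close> by auto
    have less: "a < ereal z \<and> ereal z < b" if "x < z" "z < y" for z
      using ab(2) that by (auto simp: einterval_iff subset_iff)
    obtain z where z: "x < z" "z < y"
      using dense \<open>x < y\<close> by blast
    have "a \<le> ereal x"
    proof (rule ccontr)
      assume "\<not> a \<le> ereal x"
      then obtain w where w: "ereal x < ereal w" "ereal w < a"
        using ereal_dense2[of "ereal x" a] by (auto simp: not_le)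
      have "ereal w < ereal z"
        using w(2) less[OF z] by (blast intro: less_trans)
      then show False
        using less[of w] w z by auto
    qed
    moreover have "ereal x < b"
      using z(1) less[OF z] by (auto intro: less_trans[of "ereal x" "ereal z"])
    then have "\<not> a < ereal x"
      using in_components_subset[OF ab(1)] assms(1) by (auto simp: einterval_iff)
    ultimately have "a = ereal x"
      by simp
    then show False
      using assms(2) ab(1) False by (auto simp: N_minus_def)
  qed
qed

text \<open>Mirror image: a constant stretch to the left of \<open>x\<close> would make
  \<open>x\<close> the right endpoint of a component, hence a member of
  \<open>N_plus g\<close>.\<close>

lemma g_less_left:
  assumes "x \<notin> C_set g" "x \<notin> D_set g" "ereal x \<notin> N_plus g" "y < x"
  shows "g y < g x"
proof (rule ccontr)
  assume "\<not> g y < g x"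
  then have "g y = g x"
    using g_mono[of y x] \<open>y < x\<close> by simp
  then obtain a b where ab: "einterval a b \<in> components (C_set g)" "{y<..<x} \<subseteq> einterval a b"
    using subset_component[OF connected_Ioo Ioo_subset_C_set[of y x]] \<open>y < x\<close> by auto
  have less: "a < ereal z \<and> ereal z < b" if "y < z" "z < x" for z
    using ab(2) that by (auto simp: einterval_iff subset_iff)
  obtain z where z: "y < z" "z < x"
    using dense \<open>y < x\<close> by blast
  have "ereal x \<le> b"
  proof (rule ccontr)
    assume "\<not> ereal x \<le> b"
    then obtain w where w: "b < ereal w" "ereal w < ereal x"
      using ereal_dense2[of b "ereal x"] by (auto simp: not_le)
    have "ereal z < ereal w"
      using w(1) less[OF z] by (blast intro: less_trans)
    then show False
      using less[of w] w z by auto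
  qed
  moreover have "a < ereal x"
    using z(2) less[OF z] by (auto intro: less_trans[of a "ereal z"])
  then have "\<not> ereal x < b"
    using in_components_subset[OF ab(1)] assms(1) by (auto simp: einterval_iff)
  ultimately have "b = ereal x"
    by simp
  then show False
    using assms(2,3) ab(1) by (auto simp: N_plus_def)
qed

section \<open>Existence and uniqueness of the derivative\<close>

text \<open>Reduces all cases of the definition to one-sided limits at points from which
  \<open>g\<close> grows strictly on that side. Inside a component the limit is taken at the right
  endpoint \<open>b\<close>; that \<open>w\<close> is constant on level sets of \<open>g\<close>
  turns \<open>w b\<close> into \<open>w x\<close>.\<close>

lemma has_g_derivativeI:
  fixes f w :: "real \<Rightarrow> 'a::real_normed_vector"
  assumes "\<infinity> \<notin> N_plus g" "t < x"
    and w: "\<And>y. t < y \<Longrightarrow> g y = g x \<Longrightarrow> w y = w x"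
    and right: "\<And>z. t < z \<Longrightarrow> (\<And>y. z < y \<Longrightarrow> g z < g y) \<Longrightarrow> (g_quotient g f z \<longlongrightarrow> w z) (at_right z)"
    and left: "\<And>z. t < z \<Longrightarrow> (\<And>y. y < z \<Longrightarrow> g y < g z) \<Longrightarrow> (g_quotient g f z \<longlongrightarrow> w z) (at_left z)"
  shows "has_g_derivative g {t<..} f (w x) x"
proof -
  have R: "(g_quotient g f z \<longlongrightarrow> w z) (at z within {t<..} \<inter> {z<..})"
    if "t < z" "\<And>y. z < y \<Longrightarrow> g z < g y" for z
    by (rule tendsto_within_subset[OF right[OF that]]) auto
  have L: "(g_quotient g f x \<longlongrightarrow> w x) (at x within {t<..} \<inter> {..<x})"
    if "\<And>y. y < x \<Longrightarrow> g y < g x"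
    by (rule tendsto_within_subset[OF left[OF \<open>t < x\<close> that]]) auto
  consider (D) "x \<in> D_set g" | (C) "x \<notin> D_set g" "x \<in> C_set g"
    | (plus) "x \<notin> D_set g" "x \<notin> C_set g" "ereal x \<in> N_plus g"
    | (minus) "x \<notin> D_set g" "x \<notin> C_set g" "ereal x \<notin> N_plus g" "ereal x \<in> N_minus g"
    | (both) "x \<notin> D_set g" "x \<notin> C_set g" "ereal x \<notin> N_plus g" "ereal x \<notin> N_minus g"
    by blast
  then show ?thesis
  proof cases
    case D
    then have "g x < g y" if "x < y" for y
      using right_limit_le[OF that] by (simp add: D_set_iff)
    with D show ?thesis
      using R[OF \<open>t < x\<close>] by (simp add: has_g_derivative_def)
  next
    case C
    then obtain a b' where ab': "einterval a b' \<in> components (C_set g)" "{x} \<subseteq> einterval a b'"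
      using subset_component[of "{x}"] by auto
    \<comment> \<open>An infinite right endpoint would be a member of \<open>N_plus g\<close>, since
      \<open>D_set g\<close> contains only reals.\<close>
    moreover have "b' \<noteq> \<infinity>"
      using ab'(1) assms(1) by (auto simp: N_plus_def)
    moreover have "b' \<noteq> - \<infinity>"
      using ab'(2) by (auto simp: einterval_iff)
    ultimately obtain b where ab: "einterval a (ereal b) \<in> components (C_set g)" "x \<in> einterval a (ereal b)"
      by (cases b') auto
    have "t < b"
      using ab(2) \<open>t < x\<close> by (auto simp: einterval_iff)
    moreover have "w b = w x"
      using w[OF \<open>t < b\<close>] g_eq_right_endpoint_component[OF ab] by simp
    ultimately have "(g_quotient g f b \<longlongrightarrow> w x) (at b within {t<..} \<inter> {b<..})"
      using R[OF \<open>t < b\<close> g_less_right_of_component[OF ab(1)]] by simp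
    then show ?thesis
      using C ab \<open>t < b\<close> unfolding has_g_derivative_def by auto
  next
    case plus
    then obtain a where "einterval a (ereal x) \<in> components (C_set g)"
      by (auto simp: N_plus_def)
    then show ?thesis
      using plus R[OF \<open>t < x\<close> g_less_right_of_component] by (simp add: has_g_derivative_def)
  next
    case minus
    then obtain b where "einterval (ereal x) b \<in> components (C_set g)"
      by (auto simp: N_minus_def)
    then show ?thesis
      using minus L[OF g_less_left_of_component] by (simp add: has_g_derivative_def)
  next
    case both
    have "(g_quotient g f x \<longlongrightarrow> w x) (at x)"
      using both \<open>t < x\<close> g_less_left g_less_right by (intro filterlim_split_at left right) auto
    then have "(g_quotient g f x \<longlongrightarrow> w x) (at x within {t<..})"
      by (rule tendsto_within_subset) auto
    with both show ?thesis
      by (simp add: has_g_derivative_def)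
  qed
qed

text \<open>Components sharing a point coincide, and the smaller of two different right endpoints
  would lie inside the interval ending at the larger one.\<close>

lemma einterval_component_unique:
  assumes "einterval a (ereal b) \<in> components (C_set g)" "einterval a' (ereal b') \<in> components (C_set g)"
    "x \<in> einterval a (ereal b)" "x \<in> einterval a' (ereal b')"
  shows "b = b'"
proof -
  have eq: "einterval a (ereal b) = einterval a' (ereal b')"
    using components_eq[OF assms(1,2)] assms(3,4) by auto
  have "b \<notin> einterval a' (ereal b')" "b' \<notin> einterval a (ereal b)"
    using eq by (auto simp: einterval_iff)
  then show ?thesis
    using assms(3,4) by (cases b b' rule: linorder_cases) (auto simp: einterval_iff intro: less_trans)
qed

text \<open>Makes the definite description in \<open>g_deriv\<close> meaningful. On an open
  half-line every filter in the definition is nontrivial, so limits are unique.\<close>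

lemma has_g_derivative_unique:
  fixes f :: "real \<Rightarrow> 'a::real_normed_vector"
  assumes "t < x" and D: "has_g_derivative g {t<..} f D x" and E: "has_g_derivative g {t<..} f E x"
  shows "D = E"
proof -
  have right: "D = E" if "t < z" "(h \<longlongrightarrow> D) (at z within {t<..} \<inter> {z<..})" "(h \<longlongrightarrow> E) (at z within {t<..} \<inter> {z<..})"
    for z and h :: "real \<Rightarrow> 'a"
  proof -
    have "{t<..} \<inter> {z<..} = {z<..}"
      using that(1) by auto
    then show ?thesis
      using that by (auto intro: tendsto_unique[of "at_right z"])
  qed
  have left: "D = E" if "(h \<longlongrightarrow> D) (at x within {t<..} \<inter> {..<x})" "(h \<longlongrightarrow> E) (at x within {t<..} \<inter> {..<x})"
    for h :: "real \<Rightarrow> 'a"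
  proof -
    have "at x within {t<..} \<inter> {..<x} = at_left x"
      using \<open>t < x\<close> by (intro at_within_nhd[of _ "{t<..}"]) auto
    then show ?thesis
      using that by (auto intro: tendsto_unique[of "at_left x"])
  qed
  \<comment> \<open>A limit within the half-line is in particular a limit from the left.\<close>
  have both: "D = E" if "(h \<longlongrightarrow> D) (at x within {t<..})" "(h \<longlongrightarrow> E) (at x within {t<..})"
    for h :: "real \<Rightarrow> 'a"
    by (rule left[of h]) (auto intro: tendsto_within_subset[OF that(1)] tendsto_within_subset[OF that(2)])
  note defs = D[unfolded has_g_derivative_def] E[unfolded has_g_derivative_def]
  consider (D) "x \<in> D_set g" | (C) "x \<notin> D_set g" "x \<in> C_set g"
    | (plus) "x \<notin> D_set g" "x \<notin> C_set g" "ereal x \<in> N_plus g"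
    | (minus) "x \<notin> D_set g" "x \<notin> C_set g" "ereal x \<notin> N_plus g" "ereal x \<in> N_minus g"
    | (two_sided) "x \<notin> D_set g" "x \<notin> C_set g" "ereal x \<notin> N_plus g" "ereal x \<notin> N_minus g"
    by blast
  then show ?thesis
  proof cases
    case D
    with defs show ?thesis
      by (intro right[OF \<open>t < x\<close>]) simp_all
  next
    case plus
    with defs show ?thesis
      by (intro right[OF \<open>t < x\<close>]) simp_all
  next
    case minus
    with defs show ?thesis
      by (intro left) simp_all
  next
    case two_sided
    with defs show ?thesis
      by (intro both) simp_all
  next
    case C
    with D E obtain a b a' b' where
      "einterval a (ereal b) \<in> components (C_set g)" "x \<in> einterval a (ereal b)"
      "einterval a' (ereal b') \<in> components (C_set g)" "x \<in> einterval a' (ereal b')"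
      "t < b" "(g_quotient g f b \<longlongrightarrow> D) (at b within {t<..} \<inter> {b<..})"
      "(g_quotient g f b' \<longlongrightarrow> E) (at b' within {t<..} \<inter> {b'<..})"
      unfolding has_g_derivative_def by auto
    moreover from this(1,3,2,4) have "b = b'"
      by (rule einterval_component_unique)
    ultimately show ?thesis
      by (intro right[of b "g_quotient g f b"]) simp_all
  qed
qed

lemma g_deriv_eqI:
  assumes "t < x" "has_g_derivative g {t<..} f D x"
  shows "g_deriv g {t<..} f x = D"
  unfolding g_deriv_def
proof (rule the_equality)
  show "E = D" if "has_g_derivative g {t<..} f E x" for E
    by (rule has_g_derivative_unique[OF assms(1) that assms(2)])
qed (rule assms(2))

section \<open>Normalized monomials\<close>

text \<open>Dividing by the factorial absorbs the factor of the recursion: each function is exactly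
  the signed integral of the preceding one.\<close>

definition normalized_monomial :: "real \<Rightarrow> nat \<Rightarrow> real \<Rightarrow> real" where
  "normalized_monomial x0 n x = g_monomial g x0 n x / fact n"

lemma normalized_monomial_0 [simp]: "normalized_monomial x0 0 = (\<lambda>x. 1)"
  by (simp add: normalized_monomial_def fun_eq_iff)

lemma normalized_monomial_Suc:
  "normalized_monomial x0 (Suc n) = signed_integral x0 (normalized_monomial x0 n)"
proof
  fix x
  have "real (Suc n) * c / fact (Suc n) = c / fact n" for c
    unfolding fact_Suc by (rule mult_divide_mult_cancel_left) simp
  then show "normalized_monomial x0 (Suc n) x = signed_integral x0 (normalized_monomial x0 n) x"
    unfolding normalized_monomial_def signed_integral_def by (simp del: of_nat_Suc fact_Suc)
qed

lemma normalized_monomial_Suc_self [simp]: "normalized_monomial x0 (Suc n) x0 = 0"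
  by (simp add: normalized_monomial_Suc signed_integral_def set_lebesgue_integral_def)

lemma locally_bounded_borel_normalized_monomial: "locally_bounded_borel (normalized_monomial x0 n)"
proof (induction n)
  case 0
  show ?case
    by (auto simp: locally_bounded_borel_def intro!: exI[of _ 1])
next
  case (Suc n)
  then show ?case
    unfolding normalized_monomial_Suc by (rule locally_bounded_borel_signed_integral)
qed

lemma normalized_monomial_diff:
  assumes "x \<le> y"
  shows "normalized_monomial x0 (Suc n) y - normalized_monomial x0 (Suc n) x
    = (LINT s:{x..<y}|\<mu>. normalized_monomial x0 n s)"
  unfolding normalized_monomial_Suc
  by (rule signed_integral_diff[OF locally_bounded_borel_normalized_monomial assms])

lemma normalized_monomial_measurable [measurable]: "normalized_monomial x0 n \<in> borel_measurable borel"
  using locally_bounded_borel_normalized_monomial by (simp add: locally_bounded_borel_def)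

lemma set_integrable_normalized_monomial: "set_integrable \<mu> {p..<q} (normalized_monomial x0 n)"
proof -
  obtain B where "\<forall>s\<in>{p..q}. \<bar>normalized_monomial x0 n s\<bar> \<le> B"
    using locally_bounded_borel_normalized_monomial unfolding locally_bounded_borel_def by blast
  then show ?thesis
    by (intro set_integrable_bounded[where B=B]) auto
qed

text \<open>Each integration of the exponential gains a factor \<open>1 / \<Lambda>\<close> by
  \<open>set_integral_exp_le\<close>. As \<open>\<Lambda>\<close> is arbitrary, the decay beats any
  geometric growth of coefficients.\<close>

lemma normalized_monomial_bound_right:
  assumes "\<Lambda> > 0" "x0 \<le> x"
  shows "\<bar>normalized_monomial x0 n x\<bar> \<le> exp (\<Lambda> * (g x - g x0)) / \<Lambda> ^ n"
  using assms(2)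
proof (induction n arbitrary: x)
  case 0
  then show ?case
    using assms(1) g_mono[of x0 x] by simp
next
  case (Suc n)
  let ?h = "normalized_monomial x0 n"
  \<comment> \<open>The additional factor \<open>\<Lambda>\<close> fits
    \<open>set_integral_exp_le\<close>; it is compensated by the exponent \<open>Suc n\<close> in
    place of \<open>n\<close>.\<close>
  let ?E = "\<lambda>s. \<Lambda> * exp (\<Lambda> * (g s - g x0))"
  have [measurable]: "g \<in> borel_measurable borel"
    using derivator by (intro borel_measurable_mono) (simp add: derivator_def)
  have E: "set_integrable \<mu> {x0..<x} (\<lambda>s. ?E s / \<Lambda> ^ Suc n)"
  proof (rule set_integrable_bounded)
    show "\<bar>?E s / \<Lambda> ^ Suc n\<bar> \<le> ?E x / \<Lambda> ^ Suc n" if "s \<in> {x0..<x}" for s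
      using that assms(1) by (auto simp: abs_mult intro!: divide_right_mono mult_left_mono g_mono)
  qed measurable
  have h: "set_integrable \<mu> {x0..<x} ?h"
    by (rule set_integrable_normalized_monomial)
  have "\<bar>normalized_monomial x0 (Suc n) x\<bar> = \<bar>LINT s:{x0..<x}|\<mu>. ?h s\<bar>"
    using Suc.prems by (simp add: normalized_monomial_Suc signed_integral_def)
  also have "\<dots> \<le> (LINT s:{x0..<x}|\<mu>. \<bar>?h s\<bar>)"
    using set_integral_norm_bound[OF h] by simp
  also have "\<dots> \<le> (LINT s:{x0..<x}|\<mu>. ?E s / \<Lambda> ^ Suc n)"
  proof (intro set_integral_mono E)
    show "set_integrable \<mu> {x0..<x} (\<lambda>s. \<bar>?h s\<bar>)"
      using set_integrable_norm[OF h] by simp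
    show "\<bar>?h s\<bar> \<le> ?E s / \<Lambda> ^ Suc n" if "s \<in> {x0..<x}" for s
      using Suc.IH[of s] that assms(1) by simp
  qed
  also have "\<dots> = (LINT s:{x0..<x}|\<mu>. ?E s) / \<Lambda> ^ Suc n"
    by simp
  also have "\<dots> \<le> exp (\<Lambda> * (g x - g x0)) / \<Lambda> ^ Suc n"
    using set_integral_exp_le[OF Suc.prems assms(1), of "g x0"] assms(1)
    by (intro divide_right_mono) auto
  finally show ?case .
qed

text \<open>The inductive bound on \<open>[x, x0)\<close> is largest at \<open>x\<close>, which
  belongs to the interval and may carry an atom; hence a plain power with no factorial.\<close>

lemma normalized_monomial_bound_left:
  assumes "x \<le> x0"
  shows "\<bar>normalized_monomial x0 n x\<bar> \<le> (g x0 - g x) ^ n"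
  using assms
proof (induction n arbitrary: x)
  case (Suc n)
  show ?case
  proof (cases "x = x0")
    case False
    have "\<bar>LINT s:{x..<x0}|\<mu>. normalized_monomial x0 n s\<bar> \<le> (g x0 - g x) ^ n * (g x0 - g x)"
    proof (rule set_integral_abs_le)
      show "\<bar>normalized_monomial x0 n s\<bar> \<le> (g x0 - g x) ^ n" if "s \<in> {x..<x0}" for s
        using that g_mono[of x s] g_mono[of s x0]
        by (intro order_trans[OF Suc.IH] power_mono) auto
    qed (use Suc.prems in measurable)
    then show ?thesis
      using False Suc.prems by (simp add: normalized_monomial_Suc signed_integral_def mult.commute)
  qed simp
qed simp

text \<open>One geometric bound for both sides of \<open>x0\<close>: on the left, closeness of
  \<open>t\<close> makes the base of the power at most \<open>1 / \<Lambda>\<close>; on the right,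
  \<open>R\<close> limits the growth of \<open>g\<close>.\<close>

lemma normalized_monomial_bound:
  assumes "\<Lambda> > 0" "\<Lambda> * (g x0 - g t) \<le> 1" "t \<le> x" "g x \<le> g x0 + R" "R \<ge> 0"
  shows "\<bar>normalized_monomial x0 n x\<bar> \<le> exp (\<Lambda> * R) / \<Lambda> ^ n"
proof (cases "x0 \<le> x")
  case True
  have "\<bar>normalized_monomial x0 n x\<bar> \<le> exp (\<Lambda> * (g x - g x0)) / \<Lambda> ^ n"
    by (rule normalized_monomial_bound_right[OF assms(1) True])
  also have "\<dots> \<le> exp (\<Lambda> * R) / \<Lambda> ^ n"
    using assms by (intro divide_right_mono) auto
  finally show ?thesis .
next
  case False
  then have "\<bar>normalized_monomial x0 n x\<bar> \<le> (g x0 - g x) ^ n"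
    by (intro normalized_monomial_bound_left) simp
  also have "\<dots> \<le> (1 / \<Lambda>) ^ n"
  proof (rule power_mono)
    have "g x0 - g x \<le> g x0 - g t"
      using g_mono[OF assms(3)] by simp
    also have "\<dots> \<le> 1 / \<Lambda>"
      using assms(1,2) by (simp add: field_simps)
    finally show "g x0 - g x \<le> 1 / \<Lambda>" .
  qed (use False g_mono[of x x0] in simp)
  also have "\<dots> \<le> exp (\<Lambda> * R) / \<Lambda> ^ n"
    using assms by (simp add: power_divide divide_right_mono)
  finally show ?thesis .
qed

text \<open>The increment is an integral of the preceding monomial; the shift of the index accounts
  for the extra factor \<open>\<Lambda>\<close>.\<close>

lemma normalized_monomial_Lipschitz:
  assumes "\<Lambda> > 0" "\<Lambda> * (g x0 - g t) \<le> 1" "t \<le> x" "x \<le> y" "g y \<le> g x0 + R" "R \<ge> 0"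
  shows "\<bar>normalized_monomial x0 n y - normalized_monomial x0 n x\<bar> \<le> \<Lambda> * exp (\<Lambda> * R) / \<Lambda> ^ n * (g y - g x)"
proof (cases n)
  case 0
  then show ?thesis
    using assms g_mono[of x y] by simp
next
  case (Suc k)
  have "\<bar>LINT s:{x..<y}|\<mu>. normalized_monomial x0 k s\<bar> \<le> exp (\<Lambda> * R) / \<Lambda> ^ k * (g y - g x)"
  proof (rule set_integral_abs_le)
    show "\<bar>normalized_monomial x0 k s\<bar> \<le> exp (\<Lambda> * R) / \<Lambda> ^ k" if "s \<in> {x..<y}" for s
      using that assms g_mono[of s y] by (intro normalized_monomial_bound) auto
  qed (use assms in measurable)
  moreover have "\<Lambda> * exp (\<Lambda> * R) / \<Lambda> ^ n = exp (\<Lambda> * R) / \<Lambda> ^ k"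
    using assms(1) Suc by simp
  ultimately show ?thesis
    by (simp only: Suc normalized_monomial_diff[OF assms(4)])
qed

section \<open>First-order errors of the monomials\<close>

text \<open>Continuity from below along \<open>[x + 1 / (n + 1), y)\<close>. Leaving out
  \<open>x\<close> removes its atom, so the bound tends to 0 as \<open>y\<close> decreases to
  \<open>x\<close>.\<close>

lemma emeasure_Ioo_le:
  "emeasure \<mu> {x<..<y} \<le> ennreal (g y - right_limit x)"
proof -
  define A where "A n = {x + inverse (real (Suc n))..<y}" for n
  have "{x<..<y} = (\<Union>n. A n)"
  proof (intro subset_antisym subsetI)
    fix z assume z: "z \<in> {x<..<y}"
    then obtain n where "inverse (real (Suc n)) < z - x"
      using reals_Archimedean[of "z - x"] by auto
    then show "z \<in> (\<Union>n. A n)"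
      using z by (auto simp: A_def intro!: exI[of _ n])
  next
    fix z assume "z \<in> (\<Union>n. A n)"
    then obtain n where "x + inverse (real (Suc n)) \<le> z" "z < y"
      by (auto simp: A_def)
    moreover have "0 < inverse (real (Suc n))"
      by simp
    ultimately show "z \<in> {x<..<y}"
      unfolding greaterThanLessThan_iff by linarith
  qed
  moreover have "incseq A"
    unfolding A_def by (intro incseq_SucI) (auto simp: le_imp_inverse_le elim!: order_trans[rotated])
  ultimately have "emeasure \<mu> {x<..<y} = (SUP n. emeasure \<mu> (A n))"
    by (subst SUP_emeasure_incseq) (auto simp: A_def)
  also have "\<dots> \<le> ennreal (g y - right_limit x)"
  proof (rule SUP_least)
    fix n
    let ?z = "x + inverse (real (Suc n))"
    show "emeasure \<mu> (A n) \<le> ennreal (g y - right_limit x)"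
    proof (cases "?z \<le> y")
      case True
      have "right_limit x \<le> g ?z"
        by (intro right_limit_le) simp
      then show ?thesis
        unfolding A_def emeasure_Ico[OF True] by (intro ennreal_leI) simp
    next
      case False
      then have "A n = {}"
        by (auto simp: A_def)
      then show ?thesis
        by simp
    qed
  qed
  finally show ?thesis .
qed

lemma set_integral_diff_const:
  fixes f :: "real \<Rightarrow> real"
  assumes "set_integrable \<mu> {p..<q} f" "p \<le> q"
  shows "(LINT s:{p..<q}|\<mu>. f s - c) = (LINT s:{p..<q}|\<mu>. f s) - c * (g q - g p)"
proof -
  have "set_integrable \<mu> {p..<q} (\<lambda>_. c)"
    by (rule set_integrable_bounded[where B="\<bar>c\<bar>"]) auto
  then show ?thesis
    using assms by (simp add: set_integral_const_Ico)
qed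

text \<open>The error is the integral of \<open>h\<^sub>n - h\<^sub>n x\<close> over \<open>[x, y)\<close>; the integrand vanishes at \<open>x\<close>, so an
  atom there does not contribute.\<close>

lemma normalized_monomial_error_right:
  assumes "\<Lambda> > 0" "\<Lambda> * (g x0 - g t) \<le> 1" "t \<le> x" "x < y" "g y \<le> g x0 + R" "R \<ge> 0"
  shows "\<bar>normalized_monomial x0 (Suc n) y - normalized_monomial x0 (Suc n) x
      - normalized_monomial x0 n x * (g y - g x)\<bar>
    \<le> \<Lambda> * exp (\<Lambda> * R) / \<Lambda> ^ n * ((g y - g x) * (g y - right_limit x))"
proof -
  let ?h = "normalized_monomial x0 n"
  define c where "c = \<Lambda> * exp (\<Lambda> * R) / \<Lambda> ^ n * (g y - g x)"
  have c: "c \<ge> 0"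
    using assms(1) g_mono[of x y] \<open>x < y\<close> by (simp add: c_def)
  have le: "\<bar>indicator {x..<y} s * (?h s - ?h x)\<bar> \<le> c * indicator {x<..<y} s" for s
  proof (cases "s \<in> {x<..<y}")
    case True
    then have "\<bar>?h s - ?h x\<bar> \<le> \<Lambda> * exp (\<Lambda> * R) / \<Lambda> ^ n * (g s - g x)"
      using assms g_mono[of s y] by (intro normalized_monomial_Lipschitz) auto
    also have "\<dots> \<le> c"
      unfolding c_def using True assms(1) g_mono[of s y] by (intro mult_left_mono) auto
    finally show ?thesis
      using True by simp
  qed (auto simp: indicator_def)
  have fin: "emeasure \<mu> {x<..<y} < \<infinity>"
    using emeasure_Ioo_le[of x y] by (rule le_less_trans) simp
  have "\<bar>LINT s:{x..<y}|\<mu>. ?h s - ?h x\<bar> \<le> (LINT s|\<mu>. c * indicator {x<..<y} s)"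
    unfolding set_lebesgue_integral_def
  proof (rule integral_abs_bound_integral)
    show "integrable \<mu> (\<lambda>s. c * indicator {x<..<y} s)"
      using fin by (intro integrable_mult_right integrable_real_indicator) auto
    have "set_integrable \<mu> {x..<y} (\<lambda>s. ?h s - ?h x)"
      by (intro set_integral_diff set_integrable_normalized_monomial
          set_integrable_bounded[where B="\<bar>?h x\<bar>"]) auto
    then show "integrable \<mu> (\<lambda>s. indicator {x..<y} s *\<^sub>R (?h s - ?h x))"
      by (simp add: set_integrable_def)
  qed (use le in simp)
  also have "\<dots> = c * measure \<mu> {x<..<y}"
    by simp
  also have "\<dots> \<le> c * (g y - right_limit x)"
  proof (rule mult_left_mono[OF _ c])
    show "measure \<mu> {x<..<y} \<le> g y - right_limit x"
      using emeasure_Ioo_le[of x y] right_limit_le[OF \<open>x < y\<close>]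
      by (simp add: measure_def enn2real_leI)
  qed
  finally show ?thesis
    using \<open>x < y\<close>
    by (simp add: set_integral_diff_const[OF set_integrable_normalized_monomial]
        normalized_monomial_diff c_def mult.assoc)
qed

text \<open>The integrand \<open>h s - h x\<close> is of order \<open>g x - g y\<close> on
  \<open>[y, x)\<close>. No correction for a jump occurs, because \<open>g y\<close> tends to
  \<open>g x\<close> from the left.\<close>

lemma normalized_monomial_error_left:
  assumes "\<Lambda> > 0" "\<Lambda> * (g x0 - g t) \<le> 1" "t \<le> y" "y < x" "g x \<le> g x0 + R" "R \<ge> 0"
  shows "\<bar>normalized_monomial x0 (Suc n) x - normalized_monomial x0 (Suc n) y
      - normalized_monomial x0 n x * (g x - g y)\<bar>
    \<le> \<Lambda> * exp (\<Lambda> * R) / \<Lambda> ^ n * ((g x - g y) * (g x - g y))"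
proof -
  let ?h = "normalized_monomial x0 n"
  define c where "c = \<Lambda> * exp (\<Lambda> * R) / \<Lambda> ^ n * (g x - g y)"
  have "\<bar>LINT s:{y..<x}|\<mu>. ?h s - ?h x\<bar> \<le> c * (g x - g y)"
  proof (rule set_integral_abs_le)
    fix s assume s: "s \<in> {y..<x}"
    then have "\<bar>?h x - ?h s\<bar> \<le> \<Lambda> * exp (\<Lambda> * R) / \<Lambda> ^ n * (g x - g s)"
      using assms by (intro normalized_monomial_Lipschitz) auto
    also have "\<dots> \<le> c"
      unfolding c_def using s assms(1) g_mono[of y s] by (intro mult_left_mono) auto
    finally show "\<bar>?h s - ?h x\<bar> \<le> c"
      by (simp add: abs_minus_commute)
  qed (measurable, use \<open>y < x\<close> in simp)
  then show ?thesis
    using \<open>y < x\<close>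
    by (simp add: set_integral_diff_const[OF set_integrable_normalized_monomial]
        normalized_monomial_diff c_def mult.assoc)
qed

end

section \<open>Series of monomials\<close>

text \<open>Division cancels the factor \<open>\<bar>g y - g x\<bar>\<close> of the error;
  \<open>B\<close> is the factor that tends to 0 in the applications.\<close>

lemma norm_g_quotient_diff_le:
  fixes g :: "real \<Rightarrow> real" and f :: "real \<Rightarrow> 'b::real_normed_vector"
  assumes "g y \<noteq> g x" "norm (f y - f x - (g y - g x) *\<^sub>R D) \<le> M * (\<bar>g y - g x\<bar> * B)"
  shows "norm (g_quotient g f x y - D) \<le> M * B"
proof -
  have "g_quotient g f x y - D = (f y - f x - (g y - g x) *\<^sub>R D) /\<^sub>R (g y - g x)"
    using assms(1) by (simp add: g_quotient_def scaleR_diff_right)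
  then have "norm (g_quotient g f x y - D) = norm (f y - f x - (g y - g x) *\<^sub>R D) / \<bar>g y - g x\<bar>"
    by (simp add: divide_inverse mult.commute)
  also have "\<dots> \<le> M * (\<bar>g y - g x\<bar> * B) / \<bar>g y - g x\<bar>"
    by (rule divide_right_mono[OF assms(2)]) simp
  finally show ?thesis
    using assms(1) by simp
qed

text \<open>The 2 in the last assumption comes from applying the monomial bounds with
  \<open>\<Lambda> = 2 * L\<close>, which leaves terms of ratio 1/2 against coefficients of order
  \<open>L ^ n\<close>.\<close>

locale monomial_series = derivator_fun +
  fixes x0 t L C :: real and A :: "nat \<Rightarrow> 'a::{real_normed_field, banach}"
  assumes L_pos: "L > 0"
    and A_bound: "norm (A n) \<le> C * L ^ n"
    and t_less: "t < x0"
    and t_close: "2 * L * (g x0 - g t) \<le> 1"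
begin

lemma C_nonneg: "C \<ge> 0"
  using order_trans[OF norm_ge_zero A_bound[of 0]] by simp

text \<open>Comparison with a geometric series of ratio 1/2, whose sum is 2. The numbers
  \<open>c n\<close> will be values, increments and linearization errors of the normalized
  monomials.\<close>

lemma coefficient_series:
  assumes "\<And>n. \<bar>c n\<bar> \<le> K / (2 * L) ^ n"
  shows "summable (\<lambda>n. norm (A (n + j) * of_real (c n)))"
    and "norm (\<Sum>n. A (n + j) * of_real (c n)) \<le> 2 * C * L ^ j * K"
proof -
  have le: "norm (A (n + j) * of_real (c n)) \<le> C * L ^ j * K * (1 / 2) ^ n" for n
  proof -
    have "norm (A (n + j) * of_real (c n)) = norm (A (n + j)) * \<bar>c n\<bar>"
      by (simp add: norm_mult)
    also have "\<dots> \<le> (C * L ^ (n + j)) * (K / (2 * L) ^ n)"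
      using C_nonneg L_pos by (intro mult_mono A_bound assms) auto
    also have "\<dots> = C * L ^ j * K * (1 / 2) ^ n"
      using L_pos by (simp add: power_add power_mult_distrib power_divide)
    finally show ?thesis .
  qed
  have s: "(\<lambda>n. C * L ^ j * K * (1 / 2) ^ n) sums (C * L ^ j * K * (1 / (1 - 1 / 2)))"
    by (intro sums_mult geometric_sums) simp
  show sm: "summable (\<lambda>n. norm (A (n + j) * of_real (c n)))"
    by (rule summable_comparison_test'[OF sums_summable[OF s], of 0]) (use le in simp)
  have "norm (\<Sum>n. A (n + j) * of_real (c n)) \<le> (\<Sum>n. norm (A (n + j) * of_real (c n)))"
    by (rule summable_norm[OF sm])
  also have "\<dots> \<le> C * L ^ j * K * (1 / (1 - 1 / 2))"
    using suminf_le[OF le sm sums_summable[OF s]] sums_unique[OF s] by simp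
  finally show "norm (\<Sum>n. A (n + j) * of_real (c n)) \<le> 2 * C * L ^ j * K"
    by (simp add: algebra_simps)
qed

text \<open>The candidate for the derivative of order \<open>j\<close>: differentiation lowers the
  index of every monomial, which amounts to shifting the coefficients.\<close>

definition v :: "nat \<Rightarrow> real \<Rightarrow> 'a" where
  "v j x = (\<Sum>n. A (n + j) * of_real (normalized_monomial x0 n x))"

lemma summable_norm_v:
  assumes "t \<le> x"
  shows "summable (\<lambda>n. norm (A (n + j) * of_real (normalized_monomial x0 n x)))"
proof (rule coefficient_series(1))
  show "\<bar>normalized_monomial x0 n x\<bar> \<le> exp (2 * L * \<bar>g x - g x0\<bar>) / (2 * L) ^ n" for n
    using L_pos t_close assms by (intro normalized_monomial_bound) auto
qed

lemmas summable_v = summable_norm_cancel[OF summable_norm_v]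

definition v_const :: "nat \<Rightarrow> real \<Rightarrow> real" where
  "v_const j R = 2 * C * L ^ j * (2 * L * exp (2 * L * R))"

lemma v_const_nonneg: "v_const j R \<ge> 0"
  using C_nonneg L_pos by (simp add: v_const_def)

lemma v_Lipschitz:
  assumes "t \<le> x" "x \<le> y" "g y \<le> g x0 + R" "R \<ge> 0"
  shows "norm (v j y - v j x) \<le> v_const j R * (g y - g x)"
proof -
  let ?c = "\<lambda>n. normalized_monomial x0 n y - normalized_monomial x0 n x"
  have "v j y - v j x = (\<Sum>n. A (n + j) * of_real (?c n))"
    unfolding v_def using assms by (subst suminf_diff) (auto intro: summable_v simp: algebra_simps)
  also have "norm \<dots> \<le> 2 * C * L ^ j * (2 * L * exp (2 * L * R) * (g y - g x))"
  proof (rule coefficient_series(2))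
    show "\<bar>?c n\<bar> \<le> 2 * L * exp (2 * L * R) * (g y - g x) / (2 * L) ^ n" for n
      using normalized_monomial_Lipschitz[of "2 * L" x0 t x y R n] L_pos t_close assms by simp
  qed
  finally show ?thesis
    by (simp add: v_const_def mult.assoc)
qed

lemma v_error:
  assumes "t \<le> x" "t \<le> y"
    and "\<And>n. \<bar>normalized_monomial x0 (Suc n) y - normalized_monomial x0 (Suc n) x
      - normalized_monomial x0 n x * (g y - g x)\<bar> \<le> 2 * L * exp (2 * L * R) / (2 * L) ^ n * B"
  shows "norm (v j y - v j x - (g y - g x) *\<^sub>R v (Suc j) x) \<le> v_const (Suc j) R * B"
proof -
  let ?h = "normalized_monomial x0"
  \<comment> \<open>The head \<open>A j\<close> is constant and cancels in the difference; in the
    tail the coefficient of \<open>?h (Suc n)\<close> is the one that \<open>?h n\<close> has in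
    \<open>v (Suc j)\<close>.\<close>
  have tail: "v j z = A j + (\<Sum>n. A (n + Suc j) * of_real (?h (Suc n) z))" if "t \<le> z" for z
    unfolding v_def using suminf_split_head[OF summable_v[OF that, of j]] by simp
  have s: "summable (\<lambda>n. A (n + Suc j) * of_real (?h (Suc n) z))" if "t \<le> z" for z
    using summable_v[OF that, of j] by (subst (asm) summable_Suc_iff[symmetric]) simp
  have "v j y - v j x - (g y - g x) *\<^sub>R v (Suc j) x
      = (\<Sum>n. A (n + Suc j) * of_real (?h (Suc n) y)) - (\<Sum>n. A (n + Suc j) * of_real (?h (Suc n) x))
        - (\<Sum>n. (g y - g x) *\<^sub>R (A (n + Suc j) * of_real (?h n x)))"
    unfolding tail[OF assms(1)] tail[OF assms(2)] v_def[of "Suc j"]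
    using suminf_scaleR_right[OF summable_v[OF assms(1)], symmetric, of "g y - g x" "Suc j"] by simp
  also have "\<dots> = (\<Sum>n. A (n + Suc j) * of_real (?h (Suc n) y) - A (n + Suc j) * of_real (?h (Suc n) x)
        - (g y - g x) *\<^sub>R (A (n + Suc j) * of_real (?h n x)))"
    unfolding suminf_diff[OF s[OF assms(2)] s[OF assms(1)]]
    by (rule suminf_diff[OF summable_diff[OF s[OF assms(2)] s[OF assms(1)]]
          summable_scaleR_right[OF summable_v[OF assms(1)]]])
  also have "\<dots> = (\<Sum>n. A (n + Suc j) * of_real (?h (Suc n) y - ?h (Suc n) x - ?h n x * (g y - g x)))"
    by (intro suminf_cong) (simp add: algebra_simps scaleR_conv_of_real)
  also have "norm \<dots> \<le> 2 * C * L ^ Suc j * (2 * L * exp (2 * L * R) * B)"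
  proof (rule coefficient_series(2))
    show "\<bar>?h (Suc n) y - ?h (Suc n) x - ?h n x * (g y - g x)\<bar>
        \<le> 2 * L * exp (2 * L * R) * B / (2 * L) ^ n" for n
      using assms(3)[of n] by simp
  qed
  finally show ?thesis
    by (simp add: v_const_def mult.assoc)
qed

lemma v_error_right:
  assumes "t \<le> x" "x < y" "g y \<le> g x0 + R" "R \<ge> 0"
  shows "norm (v j y - v j x - (g y - g x) *\<^sub>R v (Suc j) x)
    \<le> v_const (Suc j) R * ((g y - g x) * (g y - right_limit x))"
  using assms L_pos t_close by (intro v_error normalized_monomial_error_right) auto

lemma v_error_left:
  assumes "t \<le> y" "y < x" "g x \<le> g x0 + R" "R \<ge> 0"
  shows "norm (v j y - v j x - (g y - g x) *\<^sub>R v (Suc j) x)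
    \<le> v_const (Suc j) R * ((g x - g y) * (g x - g y))"
proof (rule v_error)
  fix n
  have eq: "\<bar>b - a - c * (g y - g x)\<bar> = \<bar>a - b - c * (g x - g y)\<bar>" for a b c
    by (simp add: abs_if algebra_simps)
  show "\<bar>normalized_monomial x0 (Suc n) y - normalized_monomial x0 (Suc n) x
      - normalized_monomial x0 n x * (g y - g x)\<bar>
    \<le> 2 * L * exp (2 * L * R) / (2 * L) ^ n * ((g x - g y) * (g x - g y))"
    unfolding eq using assms L_pos t_close by (intro normalized_monomial_error_left) auto
qed (use assms in auto)

lemma g_continuous_on_v: "g_continuous_on g {t<..} (v j)"
  unfolding g_continuous_on_def
proof (intro ballI allI impI)
  fix x \<epsilon> :: real assume x: "x \<in> {t<..}" and "\<epsilon> > 0"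
  \<comment> \<open>The 1 in \<open>R\<close> leaves room for \<open>g y\<close>, as the radius is
    at most 1; the 1 in \<open>M\<close> avoids division by zero.\<close>
  define R where "R = \<bar>g x - g x0\<bar> + 1"
  define M where "M = v_const j R + 1"
  have M: "M > 0" "v_const j R \<le> M"
    using v_const_nonneg[of j R] by (simp_all add: M_def)
  show "\<exists>\<delta>>0. \<forall>y\<in>{t<..}. \<bar>g y - g x\<bar> < \<delta> \<longrightarrow> norm (v j y - v j x) < \<epsilon>"
  proof (intro exI[of _ "min 1 (\<epsilon> / M)"] conjI ballI impI)
    fix y assume y: "y \<in> {t<..}" and d: "\<bar>g y - g x\<bar> < min 1 (\<epsilon> / M)"
    have R: "R \<ge> 0" "g x \<le> g x0 + R" "g y \<le> g x0 + R"
      using d by (auto simp: R_def)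
    have "norm (v j y - v j x) \<le> v_const j R * \<bar>g y - g x\<bar>"
    proof (cases "x \<le> y")
      case True
      then show ?thesis
        using v_Lipschitz[of x y R j] x R g_mono[OF True] by simp
    next
      case False
      then show ?thesis
        using v_Lipschitz[of y x R j] y R g_mono[of y x] by (simp add: norm_minus_commute)
    qed
    also have "\<dots> \<le> M * \<bar>g y - g x\<bar>"
      using M by (intro mult_right_mono) auto
    also have "\<dots> < \<epsilon>"
      using d M by (simp add: field_simps)
    finally show "norm (v j y - v j x) < \<epsilon>" .
  qed (use \<open>\<epsilon> > 0\<close> M in simp)
qed

text \<open>The error bound contains \<open>g y - right_limit x\<close>, which tends to 0 whether or
  not \<open>g\<close> jumps at \<open>x\<close>.\<close>

lemma g_quotient_v_right:
  assumes "t < x" "\<And>y. x < y \<Longrightarrow> g x < g y"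
  shows "(g_quotient g (v j) x \<longlongrightarrow> v (Suc j) x) (at_right x)"
proof -
  \<comment> \<open>Taken at \<open>x + 1\<close>, so that one constant serves all \<open>y\<close>
    between \<open>x\<close> and \<open>x + 1\<close>.\<close>
  define R where "R = \<bar>g (x + 1) - g x0\<bar>"
  have "\<forall>\<^sub>F y in at_right x. norm (g_quotient g (v j) x y - v (Suc j) x)
      \<le> v_const (Suc j) R * (g y - right_limit x)"
    unfolding eventually_at_right_field
  proof (intro exI[of _ "x + 1"] conjI allI impI)
    fix y assume y: "x < y" "y < x + 1"
    show "norm (g_quotient g (v j) x y - v (Suc j) x) \<le> v_const (Suc j) R * (g y - right_limit x)"
    proof (rule norm_g_quotient_diff_le)
      have "g y \<le> g x0 + R"
        using g_mono[of y "x + 1"] y by (simp add: R_def)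
      then show "norm (v j y - v j x - (g y - g x) *\<^sub>R v (Suc j) x)
          \<le> v_const (Suc j) R * (\<bar>g y - g x\<bar> * (g y - right_limit x))"
        using v_error_right[of x y R j] assms(1) assms(2)[OF y(1)] y by (simp add: R_def)
    qed (use assms(2)[OF y(1)] in simp)
  qed simp
  moreover have "((\<lambda>y. v_const (Suc j) R * (g y - right_limit x)) \<longlongrightarrow> v_const (Suc j) R * (right_limit x - right_limit x)) (at_right x)"
    by (intro tendsto_intros right_limit_tendsto)
  ultimately have "((\<lambda>y. g_quotient g (v j) x y - v (Suc j) x) \<longlongrightarrow> 0) (at_right x)"
    by (rule Lim_null_comparison[OF _ tendsto_eq_rhs]) simp
  then show ?thesis
    by (rule LIM_zero_cancel)
qed

lemma g_quotient_v_left: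
  assumes "t < x" "\<And>y. y < x \<Longrightarrow> g y < g x"
  shows "(g_quotient g (v j) x \<longlongrightarrow> v (Suc j) x) (at_left x)"
proof -
  define R where "R = \<bar>g x - g x0\<bar>"
  have "\<forall>\<^sub>F y in at_left x. norm (g_quotient g (v j) x y - v (Suc j) x)
      \<le> v_const (Suc j) R * (g x - g y)"
    unfolding eventually_at_left_field
  proof (intro exI[of _ t] conjI allI impI)
    fix y assume y: "t < y" "y < x"
    show "norm (g_quotient g (v j) x y - v (Suc j) x) \<le> v_const (Suc j) R * (g x - g y)"
    proof (rule norm_g_quotient_diff_le)
      show "norm (v j y - v j x - (g y - g x) *\<^sub>R v (Suc j) x)
          \<le> v_const (Suc j) R * (\<bar>g y - g x\<bar> * (g x - g y))"
        using v_error_left[of y x R j] assms(2)[OF y(2)] y by (simp add: R_def)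
    qed (use assms(2)[OF y(2)] in simp)
  qed (rule assms(1))
  moreover have "((\<lambda>y. v_const (Suc j) R * (g x - g y)) \<longlongrightarrow> v_const (Suc j) R * (g x - g x)) (at_left x)"
    by (intro tendsto_intros g_tendsto_left)
  ultimately have "((\<lambda>y. g_quotient g (v j) x y - v (Suc j) x) \<longlongrightarrow> 0) (at_left x)"
    by (rule Lim_null_comparison[OF _ tendsto_eq_rhs]) simp
  then show ?thesis
    by (rule LIM_zero_cancel)
qed

text \<open>Continuity with respect to \<open>g\<close>, applied at distance 0; this supplies the
  constancy on level sets for \<open>has_g_derivativeI\<close>.\<close>

lemma v_eq_of_g_eq:
  assumes "t < x" "t < y" "g y = g x"
  shows "v j y = v j x"
proof (rule ccontr)
  assume "v j y \<noteq> v j x"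
  then have "norm (v j y - v j x) > 0"
    by simp
  then obtain \<delta> where "\<delta> > 0" and
    d: "\<And>z. t < z \<Longrightarrow> \<bar>g z - g x\<bar> < \<delta> \<Longrightarrow> norm (v j z - v j x) < norm (v j y - v j x)"
    using g_continuous_on_v[of j] assms(1) unfolding g_continuous_on_def by (meson greaterThan_iff)
  then show False
    using d[of y] assms by simp
qed

lemma has_g_derivative_v:
  assumes "\<infinity> \<notin> N_plus g" "t < x"
  shows "has_g_derivative g {t<..} (v j) (v (Suc j) x) x"
proof (rule has_g_derivativeI[OF assms])
  show "v (Suc j) y = v (Suc j) x" if "t < y" "g y = g x" for y
    by (rule v_eq_of_g_eq[OF assms(2) that])
qed (fact g_quotient_v_right g_quotient_v_left)+

lemma v_center: "v j x0 = A j"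
  unfolding v_def using suminf_split_head[OF summable_v[of x0 j]] t_less by simp

end

section \<open>Iterated derivatives\<close>

text \<open>All limits are taken within \<open>\<Omega>\<close> at points of
  \<open>\<Omega>\<close>, including the right endpoint of a component. This is what lets
  derivatives known only on \<open>\<Omega>\<close> be differentiated again.\<close>

lemma has_g_derivative_cong:
  assumes "x \<in> \<Omega>" "\<And>y. y \<in> \<Omega> \<Longrightarrow> f y = h y"
  shows "has_g_derivative g \<Omega> f D x \<longleftrightarrow> has_g_derivative g \<Omega> h D x"
proof -
  have "(g_quotient g f z \<longlongrightarrow> D) (at z within S) \<longleftrightarrow> (g_quotient g h z \<longlongrightarrow> D) (at z within S)"
    if "z \<in> \<Omega>" "S \<subseteq> \<Omega>" for z S
    by (rule filterlim_cong) (use that assms(2) in \<open>auto simp: eventually_at_topological g_quotient_def\<close>)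
  then show ?thesis
    using assms(1) unfolding has_g_derivative_def by (simp cong: conj_cong)
qed

lemma g_deriv_cong:
  assumes "x \<in> \<Omega>" "\<And>y. y \<in> \<Omega> \<Longrightarrow> f y = h y"
  shows "g_deriv g \<Omega> f x = g_deriv g \<Omega> h x"
  using has_g_derivative_cong[of x \<Omega> f h g] assms by (simp add: g_deriv_def)

context monomial_series
begin

lemma g_deriv_v:
  assumes "\<infinity> \<notin> N_plus g" "x \<in> {t<..}" "\<And>y. y \<in> {t<..} \<Longrightarrow> f y = v j y"
  shows "g_deriv g {t<..} f x = v (Suc j) x"
  using g_deriv_cong[of x "{t<..}" f "v j" g] assms(3) g_deriv_eqI[OF _ has_g_derivative_v[OF assms(1)], of x j] assms(2)
  by simp

lemma iterated_g_deriv_v: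
  assumes "\<infinity> \<notin> N_plus g" "x \<in> {t<..}"
  shows "(g_deriv g {t<..} ^^ k) (v 0) x = v k x"
  using assms(2) by (induction k arbitrary: x) (auto intro: g_deriv_v[OF assms(1)])

text \<open>Stated for every \<open>f\<close> that agrees with \<open>v j\<close> on the half-line,
  because the induction passes to \<open>g_deriv\<close>, which is known to be
  \<open>v (Suc j)\<close> only there.\<close>

lemma C_g_v:
  assumes "\<infinity> \<notin> N_plus g" "\<And>y. y \<in> {t<..} \<Longrightarrow> f y = v j y"
  shows "f \<in> C_g g {t<..} k"
  using assms(2)
proof (induction k arbitrary: f j)
  case 0
  then show ?case
    using g_continuous_on_v[of j] by (simp add: g_continuous_on_def)
next
  case (Suc k)
  have "g_continuous_on g {t<..} f"
    using Suc.prems g_continuous_on_v[of j] by (simp add: g_continuous_on_def)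
  moreover have "has_g_derivative g {t<..} f (v (Suc j) x) x" if "x \<in> {t<..}" for x
    using has_g_derivative_v[OF assms(1), of x j] that
      has_g_derivative_cong[of x "{t<..}" f "v j" g] Suc.prems by simp
  moreover have "g_deriv g {t<..} f \<in> C_g g {t<..} k"
    by (rule Suc.IH[of _ "Suc j"]) (rule g_deriv_v[OF assms(1) _ Suc.prems])
  ultimately show ?case
    by auto
qed

end

section \<open>The recurrence and the initial value problem\<close>

text \<open>With S the sum of the norms of \<open>lam\<close>, one step multiplies the bound by at
  most S. The ratio \<open>1 + S\<close> is at least 1, so all \<open>m\<close> preceding terms
  share the bound with exponent \<open>n - 1\<close>.\<close>

lemma linear_recurrence_bound:
  fixes A lam :: "nat \<Rightarrow> 'a::real_normed_div_algebra"
  assumes "\<And>n. A (n + m) = (\<Sum>k<m. lam k * A (n + k))"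
  shows "norm (A n) \<le> (\<Sum>k<m. norm (A k)) * (1 + (\<Sum>k<m. norm (lam k))) ^ n"
proof (induction n rule: less_induct)
  case (less n)
  let ?C = "\<Sum>k<m. norm (A k)" and ?S = "\<Sum>k<m. norm (lam k)"
  have C: "?C \<ge> 0" and S: "?S \<ge> 0"
    by (simp_all add: sum_nonneg)
  show ?case
  proof (cases "n < m")
    case True
    have "norm (A n) \<le> ?C * 1"
      using True by (auto intro: member_le_sum)
    also have "\<dots> \<le> ?C * (1 + ?S) ^ n"
      using S C by (intro mult_left_mono one_le_power) auto
    finally show ?thesis .
  next
    case False
    then obtain p where n: "n = p + m"
      by (metis add.commute le_Suc_ex not_less)
    show ?thesis
    proof (cases "m = 0")
      case True
      then show ?thesis
        using assms[of n] by simp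
    next
      case m: False
      have "norm (A n) \<le> (\<Sum>k<m. norm (lam k * A (p + k)))"
        unfolding n assms by (rule norm_sum)
      also have "\<dots> \<le> (\<Sum>k<m. norm (lam k) * (?C * (1 + ?S) ^ (n - 1)))"
      proof (rule sum_mono)
        fix k assume k: "k \<in> {..<m}"
        have "norm (A (p + k)) \<le> ?C * (1 + ?S) ^ (p + k)"
          using k by (intro less.IH) (simp add: n)
        also have "\<dots> \<le> ?C * (1 + ?S) ^ (n - 1)"
          using k S C by (intro mult_left_mono power_increasing) (auto simp: n)
        finally show "norm (lam k * A (p + k)) \<le> norm (lam k) * (?C * (1 + ?S) ^ (n - 1))"
          by (simp add: norm_mult mult_left_mono)
      qed
      also have "\<dots> = ?S * (?C * (1 + ?S) ^ (n - 1))"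
        by (simp add: sum_distrib_right)
      also have "\<dots> \<le> (1 + ?S) * (?C * (1 + ?S) ^ (n - 1))"
        using S C by (intro mult_right_mono) auto
      also have "\<dots> = ?C * (1 + ?S) ^ Suc (n - 1)"
        by simp
      also have "Suc (n - 1) = n"
        using m n by simp
      finally show ?thesis .
    qed
  qed
qed

theorem theorem5p18:
  fixes g :: "real \<Rightarrow> real" and x0 :: real and m :: nat
    and lam c a :: "nat \<Rightarrow> 'a::{real_normed_field, banach}"
  assumes "derivator g"
    and "\<infinity> \<notin> N_plus g"
    and "m \<ge> 1"
    and "\<And>n. a (n + m) * fact (n + m) = (\<Sum>k<m. lam k * a (n + k) * fact (n + k))"
    and "\<And>k. k < m \<Longrightarrow> a k * fact k = c k"
  shows "\<exists>t<x0.
    let \<Omega> = {t<..};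
        v = (\<lambda>x. \<Sum>n. a n * of_real (g_monomial g x0 n x))
    in (\<forall>x\<in>\<Omega>. summable (\<lambda>n. norm (a n * of_real (g_monomial g x0 n x)))) \<and>
       v \<in> C_g_infty g \<Omega> \<and>
       (\<forall>x\<in>\<Omega>. (g_deriv g \<Omega> ^^ m) v x = (\<Sum>k<m. lam k * (g_deriv g \<Omega> ^^ k) v x)) \<and>
       (\<forall>k<m. (g_deriv g \<Omega> ^^ k) v x0 = c k)"
proof -
  interpret derivator_fun g
    by unfold_locales (rule assms(1))
  define A where "A n = a n * fact n" for n
  define L where "L = 1 + (\<Sum>k<m. norm (lam k))"
  have L: "L > 0"
    unfolding L_def by (intro add_pos_nonneg sum_nonneg) auto
  have A_rec: "A (n + m) = (\<Sum>k<m. lam k * A (n + k))" for n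
    using assms(4) by (simp add: A_def mult.assoc)
  \<comment> \<open>Left continuity at \<open>x0\<close> brings \<open>g\<close> within
    \<open>1 / (2 * L)\<close> of \<open>g x0\<close>, which is the closeness that
    \<open>monomial_series\<close> requires of \<open>t\<close>.\<close>
  have "\<forall>\<^sub>F y in at_left x0. g x0 - 1 / (2 * L) < g y"
    using L by (intro order_tendstoD[OF g_tendsto_left]) simp
  then obtain t' where t': "t' < x0" "\<And>y. t' < y \<Longrightarrow> y < x0 \<Longrightarrow> g x0 - 1 / (2 * L) < g y"
    unfolding eventually_at_left_field by blast
  \<comment> \<open>The midpoint, because the estimate holds only strictly between \<open>t'\<close>
    and \<open>x0\<close>.\<close>
  define t where "t = (t' + x0) / 2"
  have t: "t < x0" "g x0 - 1 / (2 * L) < g t"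
    using t' by (auto simp: t_def intro!: t'(2))
  interpret monomial_series g x0 t L "\<Sum>k<m. norm (A k)" A
  proof
    show "norm (A n) \<le> (\<Sum>k<m. norm (A k)) * L ^ n" for n
      unfolding L_def by (rule linear_recurrence_bound[OF A_rec])
    show "2 * L * (g x0 - g t) \<le> 1"
      using t(2) L by (simp add: field_simps)
  qed (use L t in auto)
  have term_eq: "a n * of_real (g_monomial g x0 n x) = A (n + 0) * of_real (normalized_monomial x0 n x)"
    for n x
    by (simp add: A_def normalized_monomial_def)
  have series_eq: "(\<lambda>x. \<Sum>n. a n * of_real (g_monomial g x0 n x)) = v 0"
    unfolding v_def term_eq ..
  have v_ode: "v m x = (\<Sum>k<m. lam k * v k x)" if "t < x" for x
  proof -
    \<comment> \<open>The recurrence is inserted into each coefficient; the finite sum is then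
      exchanged with the convergent series.\<close>
    have "v m x = (\<Sum>n. \<Sum>k<m. lam k * (A (n + k) * of_real (normalized_monomial x0 n x)))"
      unfolding v_def A_rec by (simp add: sum_distrib_right mult.assoc)
    also have "\<dots> = (\<Sum>k<m. lam k * v k x)"
      unfolding v_def using summable_v[of x] that
      by (subst suminf_sum) (auto intro!: sum.cong suminf_mult summable_mult)
    finally show ?thesis .
  qed
  have "v 0 \<in> C_g_infty g {t<..}"
    unfolding C_g_infty_def by (auto intro: C_g_v[OF assms(2)])
  then show ?thesis
    unfolding Let_def series_eq
    using t(1) assms(5) summable_norm_v[of _ 0]
    by (intro exI[of _ t] conjI)
      (simp_all add: term_eq iterated_g_deriv_v[OF assms(2)] v_ode v_center A_def)
qed

end
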